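(* Let $\Sigma$ be a global signature and $\mathcal V$ a countable set of variable symbols. For all program modules $\mathcal P,\mathcal P_1,\mathcal P_2$ over $\Sigma$, every set of function symbols $\sigma\subseteq FS_\Sigma$ and every function symbol renaming $\rho$, the following equalities of maps $\mathbf{TAlg}_\Sigma\to\mathbf{TAlg}_\Sigma$ hold: (a) $\mathcal T_{\mathcal P_1\cup\mathcal P_2}=\mathcal T_{\mathcal P_1}\sqcup\mathcal T_{\mathcal P_2}$; (b) $\mathcal T_{\overline{\mathcal P}^{\sigma}}=\lambda\mathcal A.\,\big(\mathcal T_{\mathcal P}^{\omega}(\bot_\Sigma)\big)|_\sigma$; (c) $\mathcal T_{\mathcal P\setminus\sigma}=\mathcal T_{\mathcal P}\sqcap\mathbb T_{exp(\mathcal P)\setminus\sigma}$; (d) $\mathcal T_{\rho(\mathcal P)}=\mathcal T_{\rho^{-1}}\circ\mathcal T_{\mathcal P}\circ\mathcal T_\rho$. Here: for $\mathcal A\in\mathbf{TAlg}_\Sigma$, $\mathcal A|_\sigma$ is the term algebra with $f^{\mathcal A|_\sigma}(\overline t)=f^{\mathcal A}(\overline t)$ if $f\in\sigma$ and $f^{\mathcal A|_\sigma}(\overline t)=\{\bot\}$ otherwise (for all tuples $\overline t$ in $\mathbf{CTerm}_\bot$); for $\tau\subseteq FS_\Sigma$, $\mathbb T_\tau$ is the constant map whose value is the term algebra $\top_\tau$ with $f^{\top_\tau}(\overline t)=\mathbf{CTerm}_\bot$ if $f\in\tau$ and $f^{\top_\tau}(\overline t)=\{\bot\}$ otherwise;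 $\mathcal T_\rho(\mathcal A)=\mathcal A_\rho$ and $\mathcal T_{\rho^{-1}}(\mathcal A)=\mathcal A_{\rho^{-1}}$, where $f^{\mathcal A_\rho}=\rho(f)^{\mathcal A}$, and $f^{\mathcal A_{\rho^{-1}}}(\overline t)=\bigcup\{g^{\mathcal A}(\overline t)\mid\rho(g)=f\}$ if some $g$ satisfies $\rho(g)=f$ and $f^{\mathcal A_{\rho^{-1}}}(\overline t)=\{\bot\}$ otherwise.
   Context: Terms. $\Sigma=(DS_\Sigma,FS_\Sigma)$ consists of countable disjoint sets of constructor symbols and of (defined) function symbols, each with an arity; $DS^n_\Sigma$, $FS^n_\Sigma$ are the symbols of arity $n\ge 0$. $\mathcal V$ is a countably infinite set of variables; $\bot$ is an extra 0-ary constructor. $\mathbf{Term}_\bot$ is the set of terms over $DS_\Sigma\cup FS_\Sigma\cup\{\bot\}$ and $\mathcal V$; $\mathbf{CTerm}_\bot$ is the subset of terms without function symbols; $\mathbf{Term}$, $\mathbf{CTerm}$ are the respective subsets of terms not containing $\bot$. $\mathbf{CSubst}_\bot$ is the set of maps $\theta:\mathcal V\to\mathbf{CTerm}_\bot$, extended to terms and written $t\theta$. Formulas are reduction statements $a\to b$ and joinability statements $a\bowtie b$ with $a,b\in\mathbf{Term}_\bot$. $\sqsubseteq$ is the least partial order on $\mathbf{CTerm}_\bot$ with $\bot\sqsubseteq t$ and $c(\overline s)\sqsubseteq c(\overline t)$ whenever $c\in DS^n_\Sigma$ and $s_i\sqsubseteq t_i$ for all $i$; $\langle t\rangle=\{s\in\mathbf{CTerm}_\bot\mid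 s\sqsubseteq t\}$. A cone is a non-empty subset of $\mathbf{CTerm}_\bot$ closed downwards under $\sqsubseteq$. Programs. A program is a set $\mathcal R$ of rules $f(\overline t)\to r\Leftarrow C$ with $f\in FS^n_\Sigma$, $\overline t$ an $n$-tuple of terms of $\mathbf{CTerm}$ in which no variable occurs twice, $r\in\mathbf{Term}_\bot$, and $C$ a finite set of joinability statements between terms of $\mathbf{Term}$. $[\mathcal R]_\bot$ is the set of all instances $(l\to r\Leftarrow C)\theta$ of rules of $\mathcal R$ with $\theta\in\mathbf{CSubst}_\bot$. Provability. $\mathcal R\vdash_{CRWL}\varphi$ means $\varphi$ is derivable with: (Bo) $e\to\bot$ for $e\in\mathbf{Term}_\bot$; (RR) $e\to e$ for $e\in\mathcal V\cup DS^0_\Sigma$; (DS) from $e_i\to t_i$ ($1\le i\le n$) infer $c(\overline e)\to c(\overline t)$, for $c\in DS^n_\Sigma$; (OR) from $e_i\to t_i$ ($1\le i\le n$), all statements of $C$, and $r\to t$ infer $f(\overline e)\to t$, if $(f(\overline t)\to r\Leftarrow C)\in[\mathcal R]_\bot$ and $t\neq\bot$; (Jo) from $a\to t$ and $b\to t$ infer $a\bowtie b$, if $t\in\mathbf{CTerm}$. Term algebras. A (CRWL-)term algebra $\mathcal A$ has carrier $\mathbf{CTerm}_\bot$, interprets each $c\in DS^n_\Sigma$ by $c^{\mathcal A}(\overline t)=\langle c(\overline t)\rangle$, and each $f\in FS^n_\Sigma$ by a monotonic map $f^{\mathcal A}$ from $(\mathbf{CTerm}_\bot)^n$ to cones ordered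 by inclusion (a cone if $n=0$). $\mathbf{TAlg}_\Sigma$ is the set of them, ordered by $\mathcal A\sqsubseteq\mathcal B$ iff $f^{\mathcal A}(\overline t)\subseteq f^{\mathcal B}(\overline t)$ for all $f,\overline t$; it is a complete lattice with $\sqcup$, $\sqcap$ given by unions and intersections of the sets $f^{\mathcal A}(\overline t)$; its bottom $\bot_\Sigma$ has $f^{\bot_\Sigma}(\overline t)=\{\bot\}$. For maps $\mathbf{TAlg}_\Sigma\to\mathbf{TAlg}_\Sigma$, $\sqcup$ and $\sqcap$ are defined pointwise. Evaluation under $\eta:\mathcal V\to\mathbf{CTerm}_\bot$: $[\![\bot]\!]^{\mathcal A}_\eta=\langle\bot\rangle$, $[\![X]\!]^{\mathcal A}_\eta=\langle\eta(X)\rangle$, $[\![h(e_1,\dots,e_n)]\!]^{\mathcal A}_\eta=\bigcup\{h^{\mathcal A}(u_1,\dots,u_n)\mid u_i\in[\![e_i]\!]^{\mathcal A}_\eta\}$. $id$ is the identity valuation. $\mathcal A\models_\eta a\bowtie b$ iff $[\![a]\!]^{\mathcal A}_\eta\cap[\![b]\!]^{\mathcal A}_\eta$ contains an element of $\mathbf{CTerm}$ (a maximal element); $\mathcal A\models_\eta C$ iff this holds for all statements of $C$. For a program $\mathcal R$, $\mathcal T_{\mathcal R}$ is given by $f^{\mathcal T_{\mathcal R}(\mathcal A)}(\overline t)=\{t\mid\exists(f(\overline s)\to r\Leftarrow C)\in[\mathcal R]_\bot,\ s_i\sqsubseteq t_i\text{ for all }i,\ \mathcal A\models_{id}C,\ t\in[\![r]\!]^{\mathcal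 A}_{id}\}\cup\{\bot\}$. $\mathcal T_{\mathcal R}^\omega(\bot_\Sigma)=\bigsqcup_{i\ge0}\mathcal T_{\mathcal R}^i(\bot_\Sigma)$ is its least fixpoint. Modules. A module is $\mathcal P=\langle\sigma_p,\sigma_e,\mathcal R\rangle$ with $\mathcal R$ a program whose rules have right-hand sides $r\ne\bot$, $\sigma_e=exp(\mathcal P)$ the set of function symbols having a defining rule in $\mathcal R$, and $\sigma_p$ the set of function symbols occurring in $\mathcal R$ without a defining rule in $\mathcal R$; $rl(\mathcal P)=\mathcal R$, and $\mathcal T_{\mathcal P}$ means $\mathcal T_{rl(\mathcal P)}$. A module is determined by its rules. Operations: - union: $rl(\mathcal P_1\cup\mathcal P_2)=rl(\mathcal P_1)\cup rl(\mathcal P_2)$; - deletion: $rl(\mathcal P\setminus\sigma)$ is the set of rules of $\mathcal P$ that define function symbols not in $\sigma$; - closure: $rl(\overline{\mathcal P}^{\sigma})=\{crr(f(\overline t),r)\mid f\in\sigma,\ t_i\in\mathbf{CTerm}_\bot,\ r\in\mathbf{CTerm}_\bot,\ r\ne\bot,\ rl(\mathcal P)\vdash_{CRWL}f(\overline t)\to r\}$, where $crr(f(\overline t),r)$ is the rule $f(\overline t')\to r\Leftarrow C$ obtained by replacing in $\overline t$ each occurrence of $\bot$ and each occurrence other than the first of a variable occurring more than once by a distinct fresh variable, and letting $C$ consist of $X\bowtie Y$ for each fresh $Y$ replacing an occurrence of a repeated variable $X$, and $X\bowtie X$ for each variable $X$ of $r$ and each variable $X$ occurring exactly once in $\overline t$;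 - renaming: a function symbol renaming is a map $\rho:FS_\Sigma\to FS_\Sigma$ preserving arities; it acts on terms and rules by replacing every function symbol $f$ by $\rho(f)$ (constructors, variables and $\bot$ fixed), and $rl(\rho(\mathcal P))=\{\rho(R)\mid R\in rl(\mathcal P)\}$. *)

theory Defs
  imports Main "HOL-Library.Countable_Set" "HOL-Library.FuncSet"
begin

text \<open>Constructor and function symbols are kept disjoint by the term constructors
  \<open>Con\<close> and \<open>Fun\<close>; variables are the elements of the type \<open>'v\<close>, which
  \<open>wf_signature\<close> requires to be countably infinite.\<close>

record ('c, 'f) signature =
  DS :: "'c set"
  FS :: "'f set"
  arc :: "'c \<Rightarrow> nat"
  arf :: "'f \<Rightarrow> nat"

definition wf_signature :: "('c, 'f) signature \<Rightarrow> 'v itself \<Rightarrow> bool" where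
  "wf_signature \<Sigma> _ \<longleftrightarrow>
     countable (DS \<Sigma>) \<and> countable (FS \<Sigma>) \<and> countable (UNIV :: 'v set) \<and> infinite (UNIV :: 'v set)"

datatype ('c, funs: 'f, vars: 'v) trm =
  Var 'v
| Bot
| Con 'c "('c, 'f, 'v) trm list"
| Fun 'f "('c, 'f, 'v) trm list"

fun wf_trm :: "('c, 'f) signature \<Rightarrow> ('c, 'f, 'v) trm \<Rightarrow> bool" where
  "wf_trm \<Sigma> (Var x) \<longleftrightarrow> True"
| "wf_trm \<Sigma> Bot \<longleftrightarrow> True"
| "wf_trm \<Sigma> (Con c ts) \<longleftrightarrow> c \<in> DS \<Sigma> \<and> length ts = arc \<Sigma> c \<and> (\<forall>t\<in>set ts. wf_trm \<Sigma> t)"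
| "wf_trm \<Sigma> (Fun f ts) \<longleftrightarrow> f \<in> FS \<Sigma> \<and> length ts = arf \<Sigma> f \<and> (\<forall>t\<in>set ts. wf_trm \<Sigma> t)"

text \<open>The occurrences of variables (\<open>Some x\<close>) and of \<open>Bot\<close> (\<open>None\<close>), from left to right.\<close>

fun leaves :: "('c, 'f, 'v) trm \<Rightarrow> 'v option list" where
  "leaves (Var x) = [Some x]"
| "leaves Bot = [None]"
| "leaves (Con c ts) = concat (map leaves ts)"
| "leaves (Fun f ts) = concat (map leaves ts)"

definition Term_bot :: "('c, 'f) signature \<Rightarrow> ('c, 'f, 'v) trm set" where
  "Term_bot \<Sigma> = {t. wf_trm \<Sigma> t}"

definition CTerm_bot :: "('c, 'f) signature \<Rightarrow> ('c, 'f, 'v) trm set" where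
  "CTerm_bot \<Sigma> = {t \<in> Term_bot \<Sigma>. funs t = {}}"

definition Term :: "('c, 'f) signature \<Rightarrow> ('c, 'f, 'v) trm set" where
  "Term \<Sigma> = {t \<in> Term_bot \<Sigma>. None \<notin> set (leaves t)}"

definition CTerm :: "('c, 'f) signature \<Rightarrow> ('c, 'f, 'v) trm set" where
  "CTerm \<Sigma> = Term \<Sigma> \<inter> CTerm_bot \<Sigma>"

definition CTuples :: "('c, 'f) signature \<Rightarrow> nat \<Rightarrow> ('c, 'f, 'v) trm list set" where
  "CTuples \<Sigma> n = {ts. length ts = n \<and> set ts \<subseteq> CTerm_bot \<Sigma>}"

fun subst :: "('v \<Rightarrow> ('c, 'f, 'v) trm) \<Rightarrow> ('c, 'f, 'v) trm \<Rightarrow> ('c, 'f, 'v) trm" where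
  "subst \<theta> (Var x) = \<theta> x"
| "subst \<theta> Bot = Bot"
| "subst \<theta> (Con c ts) = Con c (map (subst \<theta>) ts)"
| "subst \<theta> (Fun f ts) = Fun f (map (subst \<theta>) ts)"

definition CSubst_bot :: "('c, 'f) signature \<Rightarrow> ('v \<Rightarrow> ('c, 'f, 'v) trm) set" where
  "CSubst_bot \<Sigma> = {\<theta>. \<forall>x. \<theta> x \<in> CTerm_bot \<Sigma>}"

text \<open>The least reflexive and transitive relation on \<open>CTerm_bot \<Sigma>\<close> with the two required
  properties; it is antisymmetric (\<open>cle_antisym\<close>), hence the least such partial order.\<close>

inductive cle :: "('c, 'f) signature \<Rightarrow> ('c, 'f, 'v) trm \<Rightarrow> ('c, 'f, 'v) trm \<Rightarrow> bool" for \<Sigma> where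
  cle_refl: "t \<in> CTerm_bot \<Sigma> \<Longrightarrow> cle \<Sigma> t t"
| cle_trans: "cle \<Sigma> s t \<Longrightarrow> cle \<Sigma> t u \<Longrightarrow> cle \<Sigma> s u"
| cle_bot: "t \<in> CTerm_bot \<Sigma> \<Longrightarrow> cle \<Sigma> Bot t"
| cle_con: "c \<in> DS \<Sigma> \<Longrightarrow> length ts = arc \<Sigma> c \<Longrightarrow> list_all2 (cle \<Sigma>) ss ts
            \<Longrightarrow> cle \<Sigma> (Con c ss) (Con c ts)"

definition down :: "('c, 'f) signature \<Rightarrow> ('c, 'f, 'v) trm \<Rightarrow> ('c, 'f, 'v) trm set" where
  "down \<Sigma> t = {s \<in> CTerm_bot \<Sigma>. cle \<Sigma> s t}"

definition is_cone :: "('c, 'f) signature \<Rightarrow> ('c, 'f, 'v) trm set \<Rightarrow> bool" where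
  "is_cone \<Sigma> K \<longleftrightarrow> K \<noteq> {} \<and> K \<subseteq> CTerm_bot \<Sigma> \<and> (\<forall>t\<in>K. \<forall>s. cle \<Sigma> s t \<longrightarrow> s \<in> K)"

lemma Bot_CTerm_bot [simp]: "Bot \<in> CTerm_bot \<Sigma>"
  by (simp add: CTerm_bot_def Term_bot_def)

lemma Var_CTerm_bot [simp]: "Var x \<in> CTerm_bot \<Sigma>"
  by (simp add: CTerm_bot_def Term_bot_def)

lemma Con_CTerm_bot [simp]:
  "Con c ts \<in> CTerm_bot \<Sigma> \<longleftrightarrow> c \<in> DS \<Sigma> \<and> ts \<in> CTuples \<Sigma> (arc \<Sigma> c)"
  by (auto simp: CTerm_bot_def Term_bot_def CTuples_def)

lemma cle_CTerm_bot: "cle \<Sigma> s t \<Longrightarrow> s \<in> CTerm_bot \<Sigma> \<and> t \<in> CTerm_bot \<Sigma>"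
proof (induction rule: cle.induct)
  case (cle_con c ts ss)
  then show ?case
    by (auto simp: CTuples_def list_all2_conv_all_nth in_set_conv_nth)
qed auto

lemma list_cle_trans:
  assumes "list_all2 (cle \<Sigma>) ss ts" "list_all2 (cle \<Sigma>) ts us"
  shows "list_all2 (cle \<Sigma>) ss us"
  using assms by (auto simp: list_all2_conv_all_nth) (metis cle_trans)

lemma cle_cases:
  assumes "cle \<Sigma> s t"
  shows "s = Bot \<or> (\<exists>x. s = Var x \<and> t = Var x) \<or>
    (\<exists>c ss ts. s = Con c ss \<and> t = Con c ts \<and> list_all2 (cle \<Sigma>) ss ts)"
  using assms
proof (induction rule: cle.induct)
  case (cle_refl t)
  then show ?case
  proof (cases t)
    case (Con c ts)
    then have "list_all2 (cle \<Sigma>) ts ts"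
      using cle_refl by (auto simp: CTuples_def subset_iff intro!: list.rel_refl_strong cle.cle_refl)
    with Con show ?thesis by simp
  next
    case (Fun f ts)
    then show ?thesis using cle_refl by (simp add: CTerm_bot_def)
  qed simp_all
next
  case (cle_trans s t u)
  then show ?case
    by (auto dest: list_cle_trans)
next
  case (cle_con c ts ss)
  then show ?case
    by (auto elim: list_all2_mono)
qed auto

lemma cle_antisym: "cle \<Sigma> s t \<Longrightarrow> cle \<Sigma> t s \<Longrightarrow> s = t"
proof (induction s arbitrary: t)
  case (Con c ss)
  from cle_cases[OF Con.prems(1)] obtain ts
    where t: "t = Con c ts" and 1: "list_all2 (cle \<Sigma>) ss ts" by auto
  from cle_cases[OF Con.prems(2)] have 2: "list_all2 (cle \<Sigma>) ts ss" by (auto simp: t)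
  from 1 2 Con.IH have "ss = ts"
    by (auto simp: list_all2_conv_all_nth intro!: nth_equalityI)
  with t show ?case by simp
qed (auto dest: cle_cases)

lemma cone_down: "t \<in> CTerm_bot \<Sigma> \<Longrightarrow> is_cone \<Sigma> (down \<Sigma> t)"
  by (auto simp: is_cone_def down_def intro: cle_refl cle_trans dest: cle_CTerm_bot)

lemma cone_Bot: "is_cone \<Sigma> K \<Longrightarrow> Bot \<in> K"
  by (auto simp: is_cone_def intro: cle_bot)

text \<open>\<open>Rule f ts r C\<close> stands for \<open>f(ts) \<rightarrow> r \<Leftarrow> C\<close>, where a pair \<open>(a, b) \<in> C\<close> is the
  joinability statement \<open>a \<bowtie> b\<close>.\<close>

datatype ('c, 'f, 'v) rule =
  Rule 'f "('c, 'f, 'v) trm list" "('c, 'f, 'v) trm" "(('c, 'f, 'v) trm \<times> ('c, 'f, 'v) trm) set"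

fun wf_rule :: "('c, 'f) signature \<Rightarrow> ('c, 'f, 'v) rule \<Rightarrow> bool" where
  "wf_rule \<Sigma> (Rule f ts r C) \<longleftrightarrow>
     f \<in> FS \<Sigma> \<and> length ts = arf \<Sigma> f \<and> set ts \<subseteq> CTerm \<Sigma> \<and>
     (\<forall>x. count_list (concat (map leaves ts)) (Some x) \<le> 1) \<and>
     r \<in> Term_bot \<Sigma> \<and> finite C \<and> C \<subseteq> Term \<Sigma> \<times> Term \<Sigma>"

definition program :: "('c, 'f) signature \<Rightarrow> ('c, 'f, 'v) rule set \<Rightarrow> bool" where
  "program \<Sigma> R \<longleftrightarrow> (\<forall>\<rho>\<in>R. wf_rule \<Sigma> \<rho>)"

fun subst_rule :: "('v \<Rightarrow> ('c, 'f, 'v) trm) \<Rightarrow> ('c, 'f, 'v) rule \<Rightarrow> ('c, 'f, 'v) rule" where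
  "subst_rule \<theta> (Rule f ts r C) =
     Rule f (map (subst \<theta>) ts) (subst \<theta> r) (map_prod (subst \<theta>) (subst \<theta>) ` C)"

definition instances :: "('c, 'f) signature \<Rightarrow> ('c, 'f, 'v) rule set \<Rightarrow> ('c, 'f, 'v) rule set" where
  "instances \<Sigma> R = {subst_rule \<theta> \<rho> | \<theta> \<rho>. \<theta> \<in> CSubst_bot \<Sigma> \<and> \<rho> \<in> R}"

datatype ('c, 'f, 'v) formula =
  Red "('c, 'f, 'v) trm" "('c, 'f, 'v) trm"
| Join "('c, 'f, 'v) trm" "('c, 'f, 'v) trm"

inductive crwl :: "('c, 'f) signature \<Rightarrow> ('c, 'f, 'v) rule set \<Rightarrow> ('c, 'f, 'v) formula \<Rightarrow> bool"
  for \<Sigma> R where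
  Bo: "e \<in> Term_bot \<Sigma> \<Longrightarrow> crwl \<Sigma> R (Red e Bot)"
| RR_var: "crwl \<Sigma> R (Red (Var x) (Var x))"
| RR_con: "c \<in> DS \<Sigma> \<Longrightarrow> arc \<Sigma> c = 0 \<Longrightarrow> crwl \<Sigma> R (Red (Con c []) (Con c []))"
| DS: "c \<in> DS \<Sigma> \<Longrightarrow> length es = arc \<Sigma> c \<Longrightarrow> list_all2 (\<lambda>e t. crwl \<Sigma> R (Red e t)) es ts
       \<Longrightarrow> crwl \<Sigma> R (Red (Con c es) (Con c ts))"
| OR: "Rule f ts r C \<in> instances \<Sigma> R \<Longrightarrow> t \<noteq> Bot
       \<Longrightarrow> list_all2 (\<lambda>e t. crwl \<Sigma> R (Red e t)) es ts
       \<Longrightarrow> (\<forall>(a, b)\<in>C. crwl \<Sigma> R (Join a b))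
       \<Longrightarrow> crwl \<Sigma> R (Red r t)
       \<Longrightarrow> crwl \<Sigma> R (Red (Fun f es) t)"
| Jo: "t \<in> CTerm \<Sigma> \<Longrightarrow> crwl \<Sigma> R (Red a t) \<Longrightarrow> crwl \<Sigma> R (Red b t) \<Longrightarrow> crwl \<Sigma> R (Join a b)"

text \<open>Carrier and constructor interpretation of a term algebra being fixed, it is given by the
  interpretation of the function symbols. Outside the function symbols of the signature and the
  tuples of the right length the value is \<open>{}\<close>, so that equality in HOL is equality of
  term algebras, and the order \<open>\<le>\<close>, \<open>sup\<close> and \<open>inf\<close> of the HOL function space (pointwise
  \<open>\<subseteq>\<close>, \<open>\<union>\<close> and \<open>\<inter>\<close>) are those of the lattice \<open>TAlg \<Sigma>\<close>.\<close>

type_synonym ('c, 'f, 'v) talg = "'f \<Rightarrow> ('c, 'f, 'v) trm list \<Rightarrow> ('c, 'f, 'v) trm set"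

definition mk_alg :: "('c, 'f) signature \<Rightarrow> ('c, 'f, 'v) talg \<Rightarrow> ('c, 'f, 'v) talg" where
  "mk_alg \<Sigma> F = (\<lambda>f ts. if f \<in> FS \<Sigma> \<and> ts \<in> CTuples \<Sigma> (arf \<Sigma> f) then F f ts else {})"

definition TAlg :: "('c, 'f) signature \<Rightarrow> ('c, 'f, 'v) talg set" where
  "TAlg \<Sigma> = {A.
     (\<forall>f\<in>FS \<Sigma>. \<forall>ts\<in>CTuples \<Sigma> (arf \<Sigma> f). is_cone \<Sigma> (A f ts)) \<and>
     (\<forall>f\<in>FS \<Sigma>. \<forall>ss\<in>CTuples \<Sigma> (arf \<Sigma> f). \<forall>ts\<in>CTuples \<Sigma> (arf \<Sigma> f).
        list_all2 (cle \<Sigma>) ss ts \<longrightarrow> A f ss \<subseteq> A f ts) \<and>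
     mk_alg \<Sigma> A = A}"

definition bot_alg :: "('c, 'f) signature \<Rightarrow> ('c, 'f, 'v) talg" where
  "bot_alg \<Sigma> = mk_alg \<Sigma> (\<lambda>f ts. {Bot})"

definition top_alg :: "('c, 'f) signature \<Rightarrow> 'f set \<Rightarrow> ('c, 'f, 'v) talg" where
  "top_alg \<Sigma> \<tau> = mk_alg \<Sigma> (\<lambda>f ts. if f \<in> \<tau> then CTerm_bot \<Sigma> else {Bot})"

definition restr_alg ::
  "('c, 'f) signature \<Rightarrow> ('c, 'f, 'v) talg \<Rightarrow> 'f set \<Rightarrow> ('c, 'f, 'v) talg" where
  "restr_alg \<Sigma> A \<sigma> = mk_alg \<Sigma> (\<lambda>f ts. if f \<in> \<sigma> then A f ts else {Bot})"

fun eval :: "('c, 'f) signature \<Rightarrow> ('c, 'f, 'v) talg \<Rightarrow> ('v \<Rightarrow> ('c, 'f, 'v) trm)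
    \<Rightarrow> ('c, 'f, 'v) trm \<Rightarrow> ('c, 'f, 'v) trm set" where
  "eval \<Sigma> A \<eta> (Var x) = down \<Sigma> (\<eta> x)"
| "eval \<Sigma> A \<eta> Bot = down \<Sigma> Bot"
| "eval \<Sigma> A \<eta> (Con c es) = \<Union>{down \<Sigma> (Con c us) | us. list_all2 (\<in>) us (map (eval \<Sigma> A \<eta>) es)}"
| "eval \<Sigma> A \<eta> (Fun f es) = \<Union>{A f us | us. list_all2 (\<in>) us (map (eval \<Sigma> A \<eta>) es)}"

definition models_join :: "('c, 'f) signature \<Rightarrow> ('c, 'f, 'v) talg \<Rightarrow> ('v \<Rightarrow> ('c, 'f, 'v) trm)
    \<Rightarrow> ('c, 'f, 'v) trm \<Rightarrow> ('c, 'f, 'v) trm \<Rightarrow> bool" where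
  "models_join \<Sigma> A \<eta> a b \<longleftrightarrow> eval \<Sigma> A \<eta> a \<inter> eval \<Sigma> A \<eta> b \<inter> CTerm \<Sigma> \<noteq> {}"

definition T_rules ::
  "('c, 'f) signature \<Rightarrow> ('c, 'f, 'v) rule set \<Rightarrow> ('c, 'f, 'v) talg \<Rightarrow> ('c, 'f, 'v) talg" where
  "T_rules \<Sigma> R A = mk_alg \<Sigma> (\<lambda>f ts.
     {t. \<exists>ss r C. Rule f ss r C \<in> instances \<Sigma> R \<and> list_all2 (cle \<Sigma>) ss ts \<and>
           (\<forall>(a, b)\<in>C. models_join \<Sigma> A Var a b) \<and> t \<in> eval \<Sigma> A Var r} \<union> {Bot})"

definition T_omega :: "('c, 'f) signature \<Rightarrow> ('c, 'f, 'v) rule set \<Rightarrow> ('c, 'f, 'v) talg" where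
  "T_omega \<Sigma> R = (SUP i. (T_rules \<Sigma> R ^^ i) (bot_alg \<Sigma>))"

record ('c, 'f, 'v) pmodule =
  par_syms :: "'f set"
  exp_syms :: "'f set"
  rl :: "('c, 'f, 'v) rule set"

fun funs_rule :: "('c, 'f, 'v) rule \<Rightarrow> 'f set" where
  "funs_rule (Rule f ts r C) =
     insert f (\<Union>(funs ` set ts) \<union> funs r \<union> (\<Union>(a, b)\<in>C. funs a \<union> funs b))"

definition defined_by :: "('c, 'f, 'v) rule set \<Rightarrow> 'f set" where
  "defined_by R = {f. \<exists>ts r C. Rule f ts r C \<in> R}"

definition mk_module :: "('c, 'f, 'v) rule set \<Rightarrow> ('c, 'f, 'v) pmodule" where
  "mk_module R = \<lparr>par_syms = \<Union>(funs_rule ` R) - defined_by R, exp_syms = defined_by R, rl = R\<rparr>"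

definition is_module :: "('c, 'f) signature \<Rightarrow> ('c, 'f, 'v) pmodule \<Rightarrow> bool" where
  "is_module \<Sigma> P \<longleftrightarrow>
     program \<Sigma> (rl P) \<and> (\<forall>f ts r C. Rule f ts r C \<in> rl P \<longrightarrow> r \<noteq> Bot) \<and> P = mk_module (rl P)"

definition union_mod ::
  "('c, 'f, 'v) pmodule \<Rightarrow> ('c, 'f, 'v) pmodule \<Rightarrow> ('c, 'f, 'v) pmodule" where
  "union_mod P Q = mk_module (rl P \<union> rl Q)"

definition delete_mod :: "('c, 'f, 'v) pmodule \<Rightarrow> 'f set \<Rightarrow> ('c, 'f, 'v) pmodule" where
  "delete_mod P \<sigma> = mk_module {Rule f ts r C | f ts r C. Rule f ts r C \<in> rl P \<and> f \<notin> \<sigma>}"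

text \<open>\<open>refill ys t\<close> replaces the leaves of \<open>t\<close>, from left to right, by the variables \<open>ys\<close>.\<close>

fun refill :: "'v list \<Rightarrow> ('c, 'f, 'v) trm \<Rightarrow> ('c, 'f, 'v) trm"
  and refills :: "'v list \<Rightarrow> ('c, 'f, 'v) trm list \<Rightarrow> ('c, 'f, 'v) trm list" where
  "refill ys (Var x) = Var (hd ys)"
| "refill ys Bot = Var (hd ys)"
| "refill ys (Con c ts) = Con c (refills ys ts)"
| "refill ys (Fun f ts) = Fun f (refills ys ts)"
| "refills ys [] = []"
| "refills ys (t # ts) =
     refill (take (length (leaves t)) ys) t # refills (drop (length (leaves t)) ys) ts"

text \<open>In \<open>crr f ts r\<close>, the leaf number \<open>i\<close> of \<open>ts\<close> keeps its variable if this is the first occurrence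
  of that variable, and otherwise becomes the \<open>i\<close>-th element, in a fixed enumeration, of the set
  of variables that do not occur in \<open>ts\<close> or \<open>r\<close>. As there are infinitely many such
  variables, the new ones are pairwise distinct.\<close>

definition crr ::
  "'f \<Rightarrow> ('c, 'f, 'v) trm list \<Rightarrow> ('c, 'f, 'v) trm \<Rightarrow> ('c, 'f, 'v) rule" where
  "crr f ts r =
     (let L = concat (map leaves ts);
          fresh = from_nat_into (- (\<Union>(vars ` set ts) \<union> vars r));
          kept = (\<lambda>i. L ! i \<noteq> None \<and> L ! i \<notin> set (take i L));
          ys = map (\<lambda>i. if kept i then the (L ! i) else fresh i) [0..<length L]
      in Rule f (refills ys ts) r
           ({(Var x, Var (ys ! i)) | x i. i < length L \<and> L ! i = Some x \<and> \<not> kept i} \<union>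
            {(Var x, Var x) | x. x \<in> vars r \<or> count_list L (Some x) = 1}))"

definition closure_mod ::
  "('c, 'f) signature \<Rightarrow> ('c, 'f, 'v) pmodule \<Rightarrow> 'f set \<Rightarrow> ('c, 'f, 'v) pmodule" where
  "closure_mod \<Sigma> P \<sigma> = mk_module
     {crr f ts r | f ts r. f \<in> \<sigma> \<and> ts \<in> CTuples \<Sigma> (arf \<Sigma> f) \<and> r \<in> CTerm_bot \<Sigma> \<and> r \<noteq> Bot \<and>
        crwl \<Sigma> (rl P) (Red (Fun f ts) r)}"

definition renaming :: "('c, 'f) signature \<Rightarrow> ('f \<Rightarrow> 'f) \<Rightarrow> bool" where
  "renaming \<Sigma> \<rho> \<longleftrightarrow> \<rho> \<in> FS \<Sigma> \<rightarrow> FS \<Sigma> \<and> (\<forall>f\<in>FS \<Sigma>. arf \<Sigma> (\<rho> f) = arf \<Sigma> f)"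

abbreviation rename_trm :: "('f \<Rightarrow> 'f) \<Rightarrow> ('c, 'f, 'v) trm \<Rightarrow> ('c, 'f, 'v) trm" where
  "rename_trm \<rho> \<equiv> map_trm id \<rho> id"

fun rename_rule :: "('f \<Rightarrow> 'f) \<Rightarrow> ('c, 'f, 'v) rule \<Rightarrow> ('c, 'f, 'v) rule" where
  "rename_rule \<rho> (Rule f ts r C) =
     Rule (\<rho> f) (map (rename_trm \<rho>) ts) (rename_trm \<rho> r)
       (map_prod (rename_trm \<rho>) (rename_trm \<rho>) ` C)"

definition rename_mod :: "('f \<Rightarrow> 'f) \<Rightarrow> ('c, 'f, 'v) pmodule \<Rightarrow> ('c, 'f, 'v) pmodule" where
  "rename_mod \<rho> P = mk_module (rename_rule \<rho> ` rl P)"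

definition T_mod ::
  "('c, 'f) signature \<Rightarrow> ('c, 'f, 'v) pmodule \<Rightarrow> ('c, 'f, 'v) talg \<Rightarrow> ('c, 'f, 'v) talg" where
  "T_mod \<Sigma> P = T_rules \<Sigma> (rl P)"

definition T_top ::
  "('c, 'f) signature \<Rightarrow> 'f set \<Rightarrow> ('c, 'f, 'v) talg \<Rightarrow> ('c, 'f, 'v) talg" where
  "T_top \<Sigma> \<tau> = (\<lambda>_. top_alg \<Sigma> \<tau>)"

definition T_ren ::
  "('c, 'f) signature \<Rightarrow> ('f \<Rightarrow> 'f) \<Rightarrow> ('c, 'f, 'v) talg \<Rightarrow> ('c, 'f, 'v) talg" where
  "T_ren \<Sigma> \<rho> A = mk_alg \<Sigma> (\<lambda>f ts. A (\<rho> f) ts)"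

definition T_ren_inv ::
  "('c, 'f) signature \<Rightarrow> ('f \<Rightarrow> 'f) \<Rightarrow> ('c, 'f, 'v) talg \<Rightarrow> ('c, 'f, 'v) talg" where
  "T_ren_inv \<Sigma> \<rho> A = mk_alg \<Sigma> (\<lambda>f ts.
     if \<exists>g\<in>FS \<Sigma>. \<rho> g = f then \<Union>{A g ts | g. g \<in> FS \<Sigma> \<and> \<rho> g = f} else {Bot})"

lemma TAlgI:
  assumes "\<And>f ts. f \<in> FS \<Sigma> \<Longrightarrow> ts \<in> CTuples \<Sigma> (arf \<Sigma> f) \<Longrightarrow> is_cone \<Sigma> (F f ts)"
    and "\<And>f ss ts. f \<in> FS \<Sigma> \<Longrightarrow> ss \<in> CTuples \<Sigma> (arf \<Sigma> f) \<Longrightarrow> ts \<in> CTuples \<Sigma> (arf \<Sigma> f) \<Longrightarrow>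
           list_all2 (cle \<Sigma>) ss ts \<Longrightarrow> F f ss \<subseteq> F f ts"
  shows "mk_alg \<Sigma> F \<in> TAlg \<Sigma>"
proof -
  have "mk_alg \<Sigma> (mk_alg \<Sigma> F) = mk_alg \<Sigma> F" by (intro ext) (simp add: mk_alg_def)
  then show ?thesis using assms by (simp add: TAlg_def) (simp add: mk_alg_def)
qed

lemma TAlg_cone:
  "A \<in> TAlg \<Sigma> \<Longrightarrow> f \<in> FS \<Sigma> \<Longrightarrow> ts \<in> CTuples \<Sigma> (arf \<Sigma> f) \<Longrightarrow> is_cone \<Sigma> (A f ts)"
  by (auto simp: TAlg_def)

lemma TAlg_mono:
  "A \<in> TAlg \<Sigma> \<Longrightarrow> f \<in> FS \<Sigma> \<Longrightarrow> ss \<in> CTuples \<Sigma> (arf \<Sigma> f) \<Longrightarrow> ts \<in> CTuples \<Sigma> (arf \<Sigma> f) \<Longrightarrow>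
   list_all2 (cle \<Sigma>) ss ts \<Longrightarrow> A f ss \<subseteq> A f ts"
  unfolding TAlg_def by blast

lemma TAlg_mk_alg: "A \<in> TAlg \<Sigma> \<Longrightarrow> mk_alg \<Sigma> A = A"
  by (simp add: TAlg_def)

lemma cone_singleton_Bot: "is_cone \<Sigma> {Bot}"
  by (auto simp: is_cone_def dest: cle_cases)

lemma cone_CTerm_bot: "is_cone \<Sigma> (CTerm_bot \<Sigma>)"
  using Bot_CTerm_bot[of \<Sigma>] unfolding is_cone_def
  by (intro conjI ballI allI impI; (blast dest: cle_CTerm_bot)?)

lemma cone_Union: "\<K> \<noteq> {} \<Longrightarrow> (\<And>K. K \<in> \<K> \<Longrightarrow> is_cone \<Sigma> K) \<Longrightarrow> is_cone \<Sigma> (\<Union>\<K>)"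
proof -
  assume "\<K> \<noteq> {}" and K: "\<And>K. K \<in> \<K> \<Longrightarrow> is_cone \<Sigma> K"
  then obtain K0 where "K0 \<in> \<K>" by auto
  then have "Bot \<in> \<Union>\<K>" using cone_Bot[OF K] by blast
  then show ?thesis using K unfolding is_cone_def by (intro conjI) blast+
qed

lemma list_all2_in_CTuples:
  assumes "list_all2 (\<in>) us Ks" "\<And>K. K \<in> set Ks \<Longrightarrow> is_cone \<Sigma> K"
  shows "us \<in> CTuples \<Sigma> (length Ks)"
  using assms by (induction rule: list_all2_induct) (auto simp: CTuples_def is_cone_def)

lemma eval_cone:
  assumes A: "A \<in> TAlg \<Sigma>" and \<eta>: "\<And>x. \<eta> x \<in> CTerm_bot \<Sigma>"
  shows "wf_trm \<Sigma> e \<Longrightarrow> is_cone \<Sigma> (eval \<Sigma> A \<eta> e)"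
proof (induction e)
  case (Con c es)
  let ?U = "{us. list_all2 (\<in>) us (map (eval \<Sigma> A \<eta>) es)}"
  have c: "is_cone \<Sigma> (eval \<Sigma> A \<eta> e)" if "e \<in> set es" for e using Con that by auto
  have ne: "map (\<lambda>_. Bot) es \<in> ?U"
    using cone_Bot[OF c] by (simp add: list_all2_conv_all_nth)
  have wf: "us \<in> CTuples \<Sigma> (arc \<Sigma> c)" if "us \<in> ?U" for us
    using list_all2_in_CTuples[of us "map (eval \<Sigma> A \<eta>) es" \<Sigma>] that c Con.prems by auto
  show ?case using ne wf Con.prems
    by (auto intro!: cone_Union cone_down)
next
  case (Fun f es)
  let ?U = "{us. list_all2 (\<in>) us (map (eval \<Sigma> A \<eta>) es)}"
  have c: "is_cone \<Sigma> (eval \<Sigma> A \<eta> e)" if "e \<in> set es" for e using Fun that by auto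
  have ne: "map (\<lambda>_. Bot) es \<in> ?U"
    using cone_Bot[OF c] by (simp add: list_all2_conv_all_nth)
  have wf: "us \<in> CTuples \<Sigma> (arf \<Sigma> f)" if "us \<in> ?U" for us
    using list_all2_in_CTuples[of us "map (eval \<Sigma> A \<eta>) es" \<Sigma>] that c Fun.prems by auto
  show ?case using ne wf Fun.prems
    by (auto intro!: cone_Union TAlg_cone[OF A])
qed (auto intro: cone_down \<eta>)

lemma wf_subst: "wf_trm \<Sigma> t \<Longrightarrow> \<theta> \<in> CSubst_bot \<Sigma> \<Longrightarrow> wf_trm \<Sigma> (subst \<theta> t)"
  by (induction t) (auto simp: CSubst_bot_def CTerm_bot_def Term_bot_def)

lemma T_rules_TAlg:
  assumes "program \<Sigma> R" and A: "A \<in> TAlg \<Sigma>"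
  shows "T_rules \<Sigma> R A \<in> TAlg \<Sigma>"
proof -
  have wf: "wf_trm \<Sigma> r" if "Rule f ss r C \<in> instances \<Sigma> R" for f ss r C
  proof -
    from that obtain \<theta> \<rho> where *: "\<theta> \<in> CSubst_bot \<Sigma>" "\<rho> \<in> R" "Rule f ss r C = subst_rule \<theta> \<rho>"
      by (auto simp: instances_def)
    from *(2) assms(1) have "wf_rule \<Sigma> \<rho>" by (simp add: program_def)
    with * show ?thesis by (cases \<rho>) (auto simp: Term_bot_def intro: wf_subst)
  qed
  have c: "is_cone \<Sigma> (eval \<Sigma> A Var r)" if "Rule f ss r C \<in> instances \<Sigma> R" for f ss r C
    using eval_cone[OF A _ wf[OF that]] by simp
  show ?thesis
    unfolding T_rules_def
  proof (rule TAlgI, goal_cases)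
    case (1 f ts)
    let ?K = "{eval \<Sigma> A Var r | ss r C. Rule f ss r C \<in> instances \<Sigma> R \<and>
      list_all2 (cle \<Sigma>) ss ts \<and> (\<forall>(a, b)\<in>C. models_join \<Sigma> A Var a b)}"
    have "is_cone \<Sigma> (\<Union>(insert {Bot} ?K))"
      by (rule cone_Union) (auto intro: c cone_singleton_Bot)
    moreover have "\<Union>(insert {Bot} ?K) = {t. \<exists>ss r C. Rule f ss r C \<in> instances \<Sigma> R \<and>
      list_all2 (cle \<Sigma>) ss ts \<and> (\<forall>(a, b)\<in>C. models_join \<Sigma> A Var a b) \<and>
      t \<in> eval \<Sigma> A Var r} \<union> {Bot}"
      by blast
    ultimately show ?case by simp
  next
    case (2 f ss ts)
    have "list_all2 (cle \<Sigma>) us ss \<Longrightarrow> list_all2 (cle \<Sigma>) us ts" for us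
      using 2(4) list_cle_trans by blast
    then show ?case by blast
  qed
qed

lemma T_mod_TAlg: "is_module \<Sigma> P \<Longrightarrow> A \<in> TAlg \<Sigma> \<Longrightarrow> T_mod \<Sigma> P A \<in> TAlg \<Sigma>"
  by (simp add: T_mod_def is_module_def T_rules_TAlg)

lemma top_alg_TAlg: "top_alg \<Sigma> \<tau> \<in> TAlg \<Sigma>"
  unfolding top_alg_def by (rule TAlgI) (auto intro: cone_CTerm_bot cone_singleton_Bot)

lemma bot_alg_TAlg: "bot_alg \<Sigma> \<in> TAlg \<Sigma>"
  unfolding bot_alg_def by (rule TAlgI) (auto intro: cone_singleton_Bot)

lemma bot_alg_least: "A \<in> TAlg \<Sigma> \<Longrightarrow> bot_alg \<Sigma> \<le> A"
  by (auto simp: bot_alg_def mk_alg_def le_fun_def intro: TAlg_cone cone_Bot)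

lemma restr_alg_TAlg: "A \<in> TAlg \<Sigma> \<Longrightarrow> restr_alg \<Sigma> A \<sigma> \<in> TAlg \<Sigma>"
  unfolding restr_alg_def
  by (rule TAlgI) (auto intro: cone_singleton_Bot TAlg_cone dest: TAlg_mono)

lemma T_ren_TAlg: "renaming \<Sigma> \<rho> \<Longrightarrow> A \<in> TAlg \<Sigma> \<Longrightarrow> T_ren \<Sigma> \<rho> A \<in> TAlg \<Sigma>"
  unfolding T_ren_def renaming_def
  by (rule TAlgI, rule TAlg_cone, auto simp: Pi_iff, rule TAlg_mono[THEN subsetD], auto)

lemma T_ren_inv_TAlg:
  assumes "renaming \<Sigma> \<rho>" "A \<in> TAlg \<Sigma>" shows "T_ren_inv \<Sigma> \<rho> A \<in> TAlg \<Sigma>"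
  unfolding T_ren_inv_def
proof (rule TAlgI, goal_cases)
  case (1 f ts)
  then have "is_cone \<Sigma> (A g ts)" if "g \<in> FS \<Sigma>" "\<rho> g = f" for g
    using assms that by (intro TAlg_cone) (auto simp: renaming_def)
  then show ?case
    by (auto intro!: cone_Union cone_singleton_Bot)
next
  case (2 f ss ts)
  then have "A g ss \<subseteq> A g ts" if "g \<in> FS \<Sigma>" "\<rho> g = f" for g
    using assms that by (intro TAlg_mono[of A \<Sigma>]) (auto simp: renaming_def)
  then show ?case by auto
qed

lemma SUP_TAlg:
  assumes "\<A> \<noteq> {}" "\<A> \<subseteq> TAlg \<Sigma>" shows "Sup \<A> \<in> TAlg \<Sigma>"
proof -
  have "mk_alg \<Sigma> (Sup \<A>) = Sup \<A>"
  proof (intro ext)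
    fix f ts
    have *: "A f ts = mk_alg \<Sigma> A f ts" if "A \<in> \<A>" for A
      using that assms(2) TAlg_mk_alg by (metis subsetD)
    show "mk_alg \<Sigma> (Sup \<A>) f ts = Sup \<A> f ts"
    proof (cases "f \<in> FS \<Sigma> \<and> ts \<in> CTuples \<Sigma> (arf \<Sigma> f)")
      case False
      then have "A f ts = {}" if "A \<in> \<A>" for A
        using *[OF that] by (metis mk_alg_def)
      with False show ?thesis by (simp add: mk_alg_def)
    qed (simp add: mk_alg_def)
  qed
  moreover have "mk_alg \<Sigma> (Sup \<A>) \<in> TAlg \<Sigma>"
  proof (rule TAlgI, goal_cases)
    case (1 f ts)
    then show ?case using assms
      by (auto simp: image_image intro!: cone_Union intro: TAlg_cone)
  next
    case (2 f ss ts)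
    then have "A f ss \<subseteq> A f ts" if "A \<in> \<A>" for A
      using assms that by (intro TAlg_mono) auto
    then show ?case by auto
  qed
  ultimately show ?thesis by simp
qed

lemma T_omega_TAlg:
  assumes "program \<Sigma> R" shows "T_omega \<Sigma> R \<in> TAlg \<Sigma>"
proof -
  have "(T_rules \<Sigma> R ^^ i) (bot_alg \<Sigma>) \<in> TAlg \<Sigma>" for i
    by (induction i) (auto intro: bot_alg_TAlg T_rules_TAlg assms)
  then show ?thesis unfolding T_omega_def by (intro SUP_TAlg) auto
qed

end

theory Submission
  imports Defs
begin

text \<open>Parts (a) and (c) hold pointwise, and (d) because evaluating \<open>\<rho>(e)\<close> in \<open>\<A>\<close> is
  evaluating \<open>e\<close> in \<open>\<A>\<^sub>\<rho>\<close>. For (b), \<open>T_omega\<close> at \<open>f(ts)\<close> consists of the terms to which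
  \<open>f(ts)\<close> is CRWL-reducible: a derivation only uses finitely many approximations, so
  it is validated by all sufficiently late iterates. The conditions attached by \<open>crr\<close>
  force an instance of a closure rule to be total on the variables of the original reduction and to
  identify the copies of a repeated variable, and derivability is stable under total
  substitutions; hence the closure rules produce nothing new. Conversely each reduction is
  recovered from its own closure rule by undoing the linearisation.\<close>

subsection \<open>Terms and instances\<close>

lemma CTuples_iff: "ts \<in> CTuples \<Sigma> n \<longleftrightarrow> length ts = n \<and> (\<forall>t\<in>set ts. t \<in> CTerm_bot \<Sigma>)"
  by (auto simp: CTuples_def)

lemma CTerm_bot_wf: "t \<in> CTerm_bot \<Sigma> \<Longrightarrow> wf_trm \<Sigma> t"
  by (simp add: CTerm_bot_def Term_bot_def)

lemma Fun_CTerm_bot [simp]: "Fun f ts \<notin> CTerm_bot \<Sigma>"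
  by (simp add: CTerm_bot_def)

lemma Var_CTerm [simp]: "Var x \<in> CTerm \<Sigma>"
  by (simp add: CTerm_def Term_def CTerm_bot_def Term_bot_def)

lemma Bot_CTerm [simp]: "Bot \<notin> CTerm \<Sigma>"
  by (simp add: CTerm_def Term_def)

lemma Fun_CTerm [simp]: "Fun f ts \<notin> CTerm \<Sigma>"
  by (simp add: CTerm_def)

lemma Con_CTerm [simp]:
  "Con c ts \<in> CTerm \<Sigma> \<longleftrightarrow> c \<in> DS \<Sigma> \<and> length ts = arc \<Sigma> c \<and> (\<forall>t\<in>set ts. t \<in> CTerm \<Sigma>)"
  by (auto simp: CTerm_def Term_def CTerm_bot_def Term_bot_def)

lemma CTerm_CTerm_bot: "t \<in> CTerm \<Sigma> \<Longrightarrow> t \<in> CTerm_bot \<Sigma>"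
  by (simp add: CTerm_def)

lemma subst_CTerm_bot:
  "t \<in> CTerm_bot \<Sigma> \<Longrightarrow> \<theta> \<in> CSubst_bot \<Sigma> \<Longrightarrow> subst \<theta> t \<in> CTerm_bot \<Sigma>"
  by (induction t) (auto simp: CSubst_bot_def CTuples_iff)

lemma subst_CTerm: "t \<in> CTerm \<Sigma> \<Longrightarrow> (\<And>x. \<theta> x \<in> CTerm \<Sigma>) \<Longrightarrow> subst \<theta> t \<in> CTerm \<Sigma>"
  by (induction t) auto

lemma subst_subst: "subst \<theta> (subst \<eta> t) = subst (\<lambda>x. subst \<theta> (\<eta> x)) t"
  by (induction t) auto

lemma subst_Var [simp]: "subst Var t = t"
  by (induction t) (auto simp: map_idI)

lemma subst_cong: "(\<And>x. x \<in> vars t \<Longrightarrow> \<theta> x = \<eta> x) \<Longrightarrow> subst \<theta> t = subst \<eta> t"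
  by (induction t) auto

lemma Some_in_leaves: "Some x \<in> set (leaves t) \<longleftrightarrow> x \<in> vars t"
  by (induction t) auto

lemma finite_vars: "finite (vars t)"
  by (induction t) auto

text \<open>Going up in \<open>cle\<close> only fills leaves \<open>Bot\<close>, and a total term
  has none left to fill.\<close>

lemma CTerm_maximal: "cle \<Sigma> s t \<Longrightarrow> s \<in> CTerm \<Sigma> \<Longrightarrow> s = t"
proof (induction s arbitrary: t)
  case (Con c ss)
  from cle_cases[OF Con.prems(1)] obtain ts
    where t: "t = Con c ts" and "list_all2 (cle \<Sigma>) ss ts" by auto
  with Con have "ss = ts"
    by (auto simp: list_all2_conv_all_nth intro!: nth_equalityI)
  with t show ?case by simp
qed (auto dest: cle_cases)

lemma list_cle_refl: "ts \<in> CTuples \<Sigma> n \<Longrightarrow> list_all2 (cle \<Sigma>) ts ts"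
  by (auto simp: CTuples_iff intro!: list.rel_refl_strong cle_refl)

text \<open>Constructors and variables mean the same in every term algebra, so \<open>A\<close> is
  never consulted, and approximating the arguments first stays within the principal cone.\<close>

lemma eval_CTerm_bot: "t \<in> CTerm_bot \<Sigma> \<Longrightarrow> eval \<Sigma> A Var t = down \<Sigma> t"
proof (induction t)
  case (Con c ts)
  have "map (eval \<Sigma> A Var) ts = map (down \<Sigma>) ts"
    using Con by (auto simp: CTuples_iff)
  then have args: "list_all2 (\<in>) us (map (eval \<Sigma> A Var) ts) \<longleftrightarrow> list_all2 (cle \<Sigma>) us ts" for us
    by (auto simp: list_all2_conv_all_nth down_def) (metis cle_CTerm_bot)
  have "cle \<Sigma> (Con c us) (Con c ts)" if "list_all2 (cle \<Sigma>) us ts" for us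
    using that Con.prems by (auto simp: CTuples_iff intro: cle_con)
  moreover have "list_all2 (cle \<Sigma>) ts ts"
    using Con.prems by (auto intro: list_cle_refl)
  ultimately show ?case
    by (auto simp: args down_def intro: cle_trans)
qed auto

text \<open>By maximality, a total term below both \<open>s\<close> and \<open>t\<close> equals
  both. Hence the conditions of \<open>crr\<close>, whose sides are variables, test an instance for
  equality and totality in the same way for all \<open>A\<close>.\<close>

lemma models_join_CTerm_bot:
  assumes "s \<in> CTerm_bot \<Sigma>" "t \<in> CTerm_bot \<Sigma>"
  shows "models_join \<Sigma> A Var s t \<longleftrightarrow> s = t \<and> t \<in> CTerm \<Sigma>"
  using assms by (auto simp: models_join_def eval_CTerm_bot down_def
      intro: cle_refl dest: CTerm_maximal)

text \<open>Monotonicity absorbs the values at all tuples below \<open>ts\<close> into the value at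
  \<open>ts\<close> itself.\<close>

lemma eval_Fun_CTuples:
  assumes A: "A \<in> TAlg \<Sigma>" and f: "f \<in> FS \<Sigma>" and ts: "ts \<in> CTuples \<Sigma> (arf \<Sigma> f)"
  shows "eval \<Sigma> A Var (Fun f ts) = A f ts"
proof -
  have "map (eval \<Sigma> A Var) ts = map (down \<Sigma>) ts"
    using ts by (auto simp: CTuples_iff eval_CTerm_bot)
  then have args: "list_all2 (\<in>) us (map (eval \<Sigma> A Var) ts) \<longleftrightarrow> list_all2 (cle \<Sigma>) us ts" for us
    by (auto simp: list_all2_conv_all_nth down_def) (metis cle_CTerm_bot)
  have "A f us \<subseteq> A f ts" if "list_all2 (cle \<Sigma>) us ts" for us
  proof (rule TAlg_mono[OF A f _ ts that])
    show "us \<in> CTuples \<Sigma> (arf \<Sigma> f)"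
      using that ts
      by (auto simp: CTuples_iff list_all2_conv_all_nth in_set_conv_nth) (metis cle_CTerm_bot)
  qed
  then show ?thesis
    using list_cle_refl[OF ts] by (auto simp: args)
qed

lemma mk_alg_outside: "\<not> (f \<in> FS \<Sigma> \<and> ts \<in> CTuples \<Sigma> (arf \<Sigma> f)) \<Longrightarrow> mk_alg \<Sigma> F f ts = {}"
  by (simp only: mk_alg_def if_False)

section \<open>Consequence operators, unions and instances of programs\<close>

lemma T_rules_Un: "T_rules \<Sigma> (R \<union> S) A = sup (T_rules \<Sigma> R A) (T_rules \<Sigma> S A)"
proof (intro ext)
  fix f ts
  have inst: "instances \<Sigma> (R \<union> S) = instances \<Sigma> R \<union> instances \<Sigma> S"
    by (auto simp: instances_def)
  show "T_rules \<Sigma> (R \<union> S) A f ts = (sup (T_rules \<Sigma> R A) (T_rules \<Sigma> S A)) f ts"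
  proof (cases "f \<in> FS \<Sigma> \<and> ts \<in> CTuples \<Sigma> (arf \<Sigma> f)")
    case True
    then show ?thesis
      unfolding T_rules_def mk_alg_def sup_apply inst by simp blast
  next
    case False
    then show ?thesis by (simp only: T_rules_def sup_apply mk_alg_outside[OF False] Un_empty_left)
  qed
qed

lemma T_rulesI:
  assumes "f \<in> FS \<Sigma>" "ts \<in> CTuples \<Sigma> (arf \<Sigma> f)" "Rule f ss r C \<in> instances \<Sigma> R"
    "list_all2 (cle \<Sigma>) ss ts" "\<forall>(a, b)\<in>C. models_join \<Sigma> A Var a b" "t \<in> eval \<Sigma> A Var r"
  shows "t \<in> T_rules \<Sigma> R A f ts"
  using assms by (auto simp: T_rules_def mk_alg_def)

text \<open>A substitution may introduce \<open>Bot\<close>, so the sides of an instantiated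
  condition are known to be well-formed but need not lie in \<open>Term\<close>.\<close>

lemma instances_wf:
  assumes "program \<Sigma> R" and "Rule f ts r C \<in> instances \<Sigma> R"
  shows "f \<in> FS \<Sigma>" "ts \<in> CTuples \<Sigma> (arf \<Sigma> f)" "wf_trm \<Sigma> r" "finite C"
    "\<And>a b. (a, b) \<in> C \<Longrightarrow> wf_trm \<Sigma> a \<and> wf_trm \<Sigma> b"
proof -
  from assms(2) obtain \<theta> Q where Q: "\<theta> \<in> CSubst_bot \<Sigma>" "Q \<in> R" "Rule f ts r C = subst_rule \<theta> Q"
    by (auto simp: instances_def)
  then obtain ts0 r0 C0 where \<theta>: "\<theta> \<in> CSubst_bot \<Sigma>" and R: "Rule f ts0 r0 C0 \<in> R"
    and eqs: "ts = map (subst \<theta>) ts0" "r = subst \<theta> r0" "C = map_prod (subst \<theta>) (subst \<theta>) ` C0"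
    by (cases Q) auto
  from R assms(1) have wf: "wf_rule \<Sigma> (Rule f ts0 r0 C0)" unfolding program_def by blast
  show "f \<in> FS \<Sigma>" "finite C" using wf by (auto simp: eqs)
  show "ts \<in> CTuples \<Sigma> (arf \<Sigma> f)"
    using wf \<theta> by (auto simp: eqs CTuples_iff intro!: subst_CTerm_bot intro: CTerm_CTerm_bot)
  show "wf_trm \<Sigma> r" using wf \<theta> by (auto simp: eqs Term_bot_def intro: wf_subst)
  show "wf_trm \<Sigma> a \<and> wf_trm \<Sigma> b" if "(a, b) \<in> C" for a b
  proof -
    from that obtain a0 b0 where "(a0, b0) \<in> C0" "a = subst \<theta> a0" "b = subst \<theta> b0"
      by (auto simp: eqs)
    moreover from this wf have "wf_trm \<Sigma> a0 \<and> wf_trm \<Sigma> b0"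
      by (auto simp: Term_def Term_bot_def)
    ultimately show ?thesis using \<theta> by (auto intro: wf_subst)
  qed
qed

fun rule_head :: "('c, 'f, 'v) rule \<Rightarrow> 'f" where
  "rule_head (Rule f ts r C) = f"

lemma rule_head_subst [simp]: "rule_head (subst_rule \<theta> Q) = rule_head Q"
  by (cases Q) auto

text \<open>Instantiation never changes the head symbol, so selecting rules by head commutes with
  it. This serves deletion.\<close>

lemma instances_filter:
  "instances \<Sigma> {Q \<in> R. P (rule_head Q)} = {Q \<in> instances \<Sigma> R. P (rule_head Q)}"
  by (auto simp: instances_def) blast

text \<open>Composing two substitutions with values in \<open>CTerm_bot\<close> yields a third; the
  (OR) case of \<open>crwl_subst\<close> rests on this.\<close>

lemma subst_instances:
  assumes "Rule f ts r C \<in> instances \<Sigma> R" and \<theta>: "\<theta> \<in> CSubst_bot \<Sigma>"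
  shows "subst_rule \<theta> (Rule f ts r C) \<in> instances \<Sigma> R"
proof -
  from assms(1) obtain \<eta> R0 where \<eta>: "\<eta> \<in> CSubst_bot \<Sigma>" and R0: "R0 \<in> R"
    and eq: "Rule f ts r C = subst_rule \<eta> R0"
    by (auto simp: instances_def)
  let ?\<mu> = "\<lambda>x. subst \<theta> (\<eta> x)"
  have "subst_rule \<theta> (subst_rule \<eta> R0) = subst_rule ?\<mu> R0"
    by (cases R0) (auto simp: subst_subst image_image map_prod_def case_prod_beta)
  moreover have "?\<mu> \<in> CSubst_bot \<Sigma>"
    using \<eta> \<theta> by (auto simp: CSubst_bot_def intro: subst_CTerm_bot[unfolded CSubst_bot_def])
  ultimately show ?thesis
    using R0 eq unfolding instances_def by auto
qed

subsection \<open>Properties of CRWL derivability\<close>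

text \<open>Reduction and joinability are derived in one inductive predicate, so both are treated in
  one induction by a \<open>case\<close> on the formula.\<close>

lemma crwl_wf:
  assumes "program \<Sigma> R" and "crwl \<Sigma> R \<phi>"
  shows "case \<phi> of Red e t \<Rightarrow> wf_trm \<Sigma> e \<and> t \<in> CTerm_bot \<Sigma> | Join a b \<Rightarrow> wf_trm \<Sigma> a \<and> wf_trm \<Sigma> b"
  using assms(2)
proof (induction rule: crwl.induct)
  case (DS c es ts)
  then show ?case by (auto simp: CTuples_iff list_all2_conv_all_nth in_set_conv_nth)
next
  case (OR f ts r C t es)
  then show ?case
    using instances_wf(1,2)[OF assms(1) OR.hyps(1)]
    by (auto simp: CTuples_iff list_all2_conv_all_nth in_set_conv_nth)
qed (auto simp: Term_bot_def CTuples_iff)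

lemma crwl_Red_wf:
  assumes "program \<Sigma> R" and "crwl \<Sigma> R (Red e t)"
  shows "wf_trm \<Sigma> e" "t \<in> CTerm_bot \<Sigma>"
  using crwl_wf[OF assms] by auto

text \<open>A term below \<open>t\<close> other than \<open>Bot\<close> is obtained by the same last
  rule from lowered premises; \<open>Bot\<close> itself comes from (Bo).\<close>

lemma crwl_down:
  assumes R: "program \<Sigma> R" and "crwl \<Sigma> R (Red e t)" and "cle \<Sigma> s t"
  shows "crwl \<Sigma> R (Red e s)"
proof -
  \<comment> \<open>The alternative \<open>s = Bot\<close> is split off because (OR) excludes
    \<open>Bot\<close> as a result; it is settled after the induction from the well-formedness of
    \<open>e\<close>.\<close>
  have "case \<phi> of Red e t \<Rightarrow> \<forall>s. cle \<Sigma> s t \<longrightarrow> s = Bot \<or> crwl \<Sigma> R (Red e s) | Join _ _ \<Rightarrow> True"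
    if "crwl \<Sigma> R \<phi>" for \<phi>
    using that
  proof (induction rule: crwl.induct)
    case (DS c es ts)
    show ?case
    proof (clarsimp, rule ccontr)
      fix s
      assume s: "cle \<Sigma> s (Con c ts)" "s \<noteq> Bot" "\<not> crwl \<Sigma> R (Red (Con c es) s)"
      from cle_cases[OF s(1)] s(2) obtain ss
        where ss: "s = Con c ss" "list_all2 (cle \<Sigma>) ss ts" by auto
      have "list_all2 (\<lambda>e t. crwl \<Sigma> R (Red e t)) es ss"
        unfolding list_all2_conv_all_nth
      proof (intro conjI allI impI)
        show len: "length es = length ss" using list_all2_lengthD[OF DS.IH] list_all2_lengthD[OF ss(2)] by simp
        fix i assume i: "i < length es"
        with DS.IH have "crwl \<Sigma> R (Red (es ! i) (ts ! i))"
          "\<forall>s. cle \<Sigma> s (ts ! i) \<longrightarrow> s = Bot \<or> crwl \<Sigma> R (Red (es ! i) s)"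
          by (auto simp: list_all2_conv_all_nth)
        moreover have "cle \<Sigma> (ss ! i) (ts ! i)" using ss i len by (auto simp: list_all2_conv_all_nth)
        \<comment> \<open>A lowered argument may be \<open>Bot\<close>, where the induction
          hypothesis gives no derivation.\<close>
        moreover have "crwl \<Sigma> R (Red (es ! i) Bot)"
          using crwl_Red_wf(1)[OF R calculation(1)] by (auto simp: Term_bot_def intro: crwl.Bo)
        ultimately show "crwl \<Sigma> R (Red (es ! i) (ss ! i))" by metis
      qed
      with DS.hyps(1,2) have "crwl \<Sigma> R (Red (Con c es) (Con c ss))" by (rule crwl.DS)
      with s ss show False by simp
    qed
  next
    case (OR f ts r C t es)
    have "list_all2 (\<lambda>e t. crwl \<Sigma> R (Red e t)) es ts" "\<forall>(a, b)\<in>C. crwl \<Sigma> R (Join a b)"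
      using OR.IH by (auto elim: list_all2_mono)
    with OR show ?case by (auto intro: crwl.OR)
  qed (auto dest!: cle_cases intro: crwl.intros)
  from this[OF assms(2)] assms(3) have "s = Bot \<or> crwl \<Sigma> R (Red e s)" by simp
  then show ?thesis
    using crwl_Red_wf(1)[OF assms(1,2)] by (auto simp: Term_bot_def intro: crwl.Bo)
qed

lemma crwl_refl: "t \<in> CTerm_bot \<Sigma> \<Longrightarrow> crwl \<Sigma> R (Red t t)"
proof (induction t)
  case (Con c ts)
  then show ?case
    by (intro crwl.DS list.rel_refl_strong) (auto simp: CTuples_iff)
qed (auto intro: crwl.intros simp: Term_bot_def)

text \<open>Totality of \<open>\<theta>\<close> is essential: the common value in rule (Jo) has to remain total.\<close>

lemma crwl_subst:
  assumes "crwl \<Sigma> R \<phi>" and \<theta>: "\<And>x. \<theta> x \<in> CTerm \<Sigma>"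
  shows "case \<phi> of Red e t \<Rightarrow> crwl \<Sigma> R (Red (subst \<theta> e) (subst \<theta> t))
    | Join a b \<Rightarrow> crwl \<Sigma> R (Join (subst \<theta> a) (subst \<theta> b))"
  using assms(1)
proof (induction rule: crwl.induct)
  case (Bo e)
  have "\<theta> \<in> CSubst_bot \<Sigma>" using \<theta> by (auto simp: CSubst_bot_def intro: CTerm_CTerm_bot)
  with Bo show ?case by (auto simp: Term_bot_def intro!: crwl.Bo wf_subst)
next
  case (RR_var x)
  show ?case using \<theta> by (auto intro: crwl_refl CTerm_CTerm_bot)
next
  case (DS c es ts)
  then show ?case by (auto simp: list_all2_conv_all_nth intro!: crwl.DS)
next
  case (OR f ts r C t es)
  have "\<theta> \<in> CSubst_bot \<Sigma>" using \<theta> by (auto simp: CSubst_bot_def intro: CTerm_CTerm_bot)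
  from subst_instances[OF OR.hyps(1) this]
  have "Rule f (map (subst \<theta>) ts) (subst \<theta> r) (map_prod (subst \<theta>) (subst \<theta>) ` C) \<in> instances \<Sigma> R"
    by simp
  \<comment> \<open>The side condition of (OR) survives: only a variable \<open>t\<close> could be
    sent to \<open>Bot\<close>, and total values rule this out.\<close>
  moreover have "subst \<theta> t \<noteq> Bot"
    using OR.hyps(2) \<theta> Bot_CTerm by (cases t) (auto, metis Bot_CTerm)
  ultimately show ?case using OR.IH
    by (auto simp: list_all2_conv_all_nth intro!: crwl.OR)
next
  case (Jo t a b)
  have "subst \<theta> t \<in> CTerm \<Sigma>" using Jo.hyps(1) \<theta> by (rule subst_CTerm)
  with Jo.IH show ?case by (auto intro: crwl.Jo)
qed (auto intro: crwl.intros)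

section \<open>Derivability and the iterates of the consequence operator\<close>

abbreviation T_iter :: "('c, 'f) signature \<Rightarrow> ('c, 'f, 'v) rule set \<Rightarrow> nat \<Rightarrow> ('c, 'f, 'v) talg" where
  "T_iter \<Sigma> R i \<equiv> (T_rules \<Sigma> R ^^ i) (bot_alg \<Sigma>)"

lemma T_iter_TAlg: "program \<Sigma> R \<Longrightarrow> T_iter \<Sigma> R i \<in> TAlg \<Sigma>"
  by (induction i) (auto intro: bot_alg_TAlg T_rules_TAlg)

lemma eval_args_CTuples:
  assumes "A \<in> TAlg \<Sigma>" "\<And>e. e \<in> set es \<Longrightarrow> wf_trm \<Sigma> e"
    and "list_all2 (\<in>) us (map (eval \<Sigma> A Var) es)"
  shows "us \<in> CTuples \<Sigma> (length es)"
  using list_all2_in_CTuples[OF assms(3), of \<Sigma>] eval_cone[OF assms(1), of Var] assms(2) by auto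

text \<open>The body and conditions of an applied rule are evaluated one stage earlier but may be
  arbitrarily large, so the outer induction is on \<open>i\<close>; arguments stay at stage
  \<open>i\<close> and are handled by an inner structural induction on \<open>e\<close>.\<close>

lemma eval_T_iter_imp_crwl:
  assumes R: "program \<Sigma> R"
  shows "wf_trm \<Sigma> e \<Longrightarrow> t \<in> eval \<Sigma> (T_iter \<Sigma> R i) Var e \<Longrightarrow> crwl \<Sigma> R (Red e t)"
proof (induction i arbitrary: e t rule: less_induct)
  case (less i)
  note outer = less.IH
  from less.prems show ?case
  proof (induction e arbitrary: t)
    case (Var x)
    then show ?case by (auto simp: down_def dest!: cle_cases intro: crwl.intros simp: Term_bot_def)
  next
    case Bot
    then show ?case by (auto simp: down_def dest!: cle_cases intro: crwl.intros simp: Term_bot_def)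
  next
    case (Con c es)
    then obtain us where us: "list_all2 (\<in>) us (map (eval \<Sigma> (T_iter \<Sigma> R i) Var) es)"
      and t: "cle \<Sigma> t (Con c us)" by (auto simp: down_def)
    have "list_all2 (\<lambda>e t. crwl \<Sigma> R (Red e t)) es us"
      using us Con by (auto simp: list_all2_conv_all_nth)
    then have "crwl \<Sigma> R (Red (Con c es) (Con c us))"
      using Con.prems by (auto intro: crwl.DS)
    then show ?case using t by (rule crwl_down[OF R])
  next
    case (Fun f es)
    then obtain us where us: "list_all2 (\<in>) us (map (eval \<Sigma> (T_iter \<Sigma> R i) Var) es)"
      and t: "t \<in> T_iter \<Sigma> R i f us" by auto
    have es: "list_all2 (\<lambda>e t. crwl \<Sigma> R (Red e t)) es us"
      using us Fun by (auto simp: list_all2_conv_all_nth)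
    show ?case
    proof (cases "t = Bot")
      case True
      then show ?thesis using Fun.prems by (auto simp: Term_bot_def intro: crwl.Bo)
    next
      case False
      \<comment> \<open>Stage 0 is \<open>bot_alg\<close>, which yields only
        \<open>Bot\<close>.\<close>
      with t obtain j where i: "i = Suc j"
        by (cases i) (auto simp: bot_alg_def mk_alg_def split: if_splits)
      with t False obtain ss r C where rule: "Rule f ss r C \<in> instances \<Sigma> R"
        and ss: "list_all2 (cle \<Sigma>) ss us"
        and C: "\<forall>(a, b)\<in>C. models_join \<Sigma> (T_iter \<Sigma> R j) Var a b"
        and r: "t \<in> eval \<Sigma> (T_iter \<Sigma> R j) Var r"
        by (auto simp: T_rules_def mk_alg_def split: if_splits)
      note wf = instances_wf[OF R rule]
      \<comment> \<open>\<open>T_rules\<close> accepts instantiated patterns below the actual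
        arguments, whereas (OR) needs the arguments to reduce to them exactly;
        \<open>crwl_down\<close> bridges the gap.\<close>
      have "list_all2 (\<lambda>e t. crwl \<Sigma> R (Red e t)) es ss"
        using es ss by (auto simp: list_all2_conv_all_nth) (metis crwl_down[OF R])
      moreover have "\<forall>(a, b)\<in>C. crwl \<Sigma> R (Join a b)"
      proof clarify
        fix a b assume ab: "(a, b) \<in> C"
        with C obtain u where "u \<in> CTerm \<Sigma>" "u \<in> eval \<Sigma> (T_iter \<Sigma> R j) Var a"
          "u \<in> eval \<Sigma> (T_iter \<Sigma> R j) Var b"
          by (fastforce simp: models_join_def)
        with wf(5)[OF ab] outer[of j] i show "crwl \<Sigma> R (Join a b)"
          by (auto intro: crwl.Jo)
      qed
      moreover have "crwl \<Sigma> R (Red r t)" using outer[of j] i wf(3) r by auto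
      ultimately show ?thesis using rule False by (auto intro: crwl.OR)
    qed
  qed
qed

text \<open>A filter is closed under finite intersections, and a list contributes only finitely many
  conditions.\<close>

lemma eventually_list_all2:
  assumes "list_all2 (\<lambda>x y. eventually (P x y) F) xs ys"
  shows "eventually (\<lambda>i. list_all2 (\<lambda>x y. P x y i) xs ys) F"
  using assms by (induction rule: list_all2_induct) (auto intro: eventually_conj)

text \<open>Saying \<open>eventually\<close> instead of naming one stage makes the induction
  compositional: finitely many premises hold jointly from some stage on, without a separate
  comparison of successive iterates.\<close>

lemma crwl_imp_eval_T_iter:
  assumes R: "program \<Sigma> R" and "crwl \<Sigma> R \<phi>"
  shows "case \<phi> of Red e t \<Rightarrow> eventually (\<lambda>i. t \<in> eval \<Sigma> (T_iter \<Sigma> R i) Var e) sequentially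
    | Join a b \<Rightarrow> eventually (\<lambda>i. models_join \<Sigma> (T_iter \<Sigma> R i) Var a b) sequentially"
  using assms(2)
proof (induction rule: crwl.induct)
  case (Bo e)
  then have "Bot \<in> eval \<Sigma> (T_iter \<Sigma> R i) Var e" for i
    using cone_Bot[OF eval_cone[OF T_iter_TAlg[OF R]]] by (auto simp: Term_bot_def)
  then show ?case by simp
next
  case (RR_var x)
  then show ?case by (simp add: down_def cle_refl)
next
  case (RR_con c)
  then show ?case by (simp add: down_def cle_refl CTuples_iff)
next
  case (DS c es ts)
  have wf: "Con c ts \<in> CTerm_bot \<Sigma>"
    using DS by (auto simp: CTuples_iff list_all2_conv_all_nth in_set_conv_nth)
      (metis crwl_Red_wf(2)[OF R])
  have "eventually (\<lambda>i. list_all2 (\<lambda>e t. t \<in> eval \<Sigma> (T_iter \<Sigma> R i) Var e) es ts) sequentially"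
    using DS.IH by (intro eventually_list_all2) (auto elim: list_all2_mono)
  then have "eventually (\<lambda>i. Con c ts \<in> eval \<Sigma> (T_iter \<Sigma> R i) Var (Con c es)) sequentially"
  proof eventually_elim
    case (elim i)
    then have "list_all2 (\<in>) ts (map (eval \<Sigma> (T_iter \<Sigma> R i) Var) es)"
      by (auto simp: list_all2_conv_all_nth)
    moreover have "Con c ts \<in> down \<Sigma> (Con c ts)"
      using wf cle_refl unfolding down_def by blast
    ultimately show ?case by auto
  qed
  then show ?case by simp
next
  case (OR f ts r C t es)
  note wf = instances_wf[OF R OR.hyps(1)]
  have "eventually (\<lambda>i. list_all2 (\<lambda>e t. t \<in> eval \<Sigma> (T_iter \<Sigma> R i) Var e) es ts) sequentially"
    using OR.IH by (intro eventually_list_all2) (auto elim: list_all2_mono)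
  \<comment> \<open>Applying a rule costs one stage: its body and conditions are taken at
    \<open>i\<close>, the call and its arguments at \<open>Suc i\<close>.\<close>
  then have es: "eventually (\<lambda>i. list_all2 (\<lambda>e t. t \<in> eval \<Sigma> (T_iter \<Sigma> R (Suc i)) Var e) es ts) sequentially"
    by (rule eventually_sequentially_Suc[THEN iffD2])
  have C: "eventually (\<lambda>i. \<forall>p\<in>C. models_join \<Sigma> (T_iter \<Sigma> R i) Var (fst p) (snd p)) sequentially"
    using OR.IH(2) wf(4) by (intro eventually_ball_finite) auto
  have r: "eventually (\<lambda>i. t \<in> eval \<Sigma> (T_iter \<Sigma> R i) Var r) sequentially"
    using OR.IH(3) by simp
  from es C r
  have "eventually (\<lambda>i. t \<in> eval \<Sigma> (T_iter \<Sigma> R (Suc i)) Var (Fun f es)) sequentially"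
  proof eventually_elim
    case (elim i)
    from elim(1) have "list_all2 (\<in>) ts (map (eval \<Sigma> (T_iter \<Sigma> R (Suc i)) Var) es)"
      by (auto simp: list_all2_conv_all_nth)
    moreover have "\<forall>(a, b)\<in>C. models_join \<Sigma> (T_iter \<Sigma> R i) Var a b"
      using elim(2) by auto
    then have "t \<in> T_iter \<Sigma> R (Suc i) f ts"
      using T_rulesI[OF wf(1,2) OR.hyps(1) list_cle_refl[OF wf(2)] _ elim(3)] by simp
    ultimately show ?case unfolding eval.simps by blast
  qed
  then have "eventually (\<lambda>i. t \<in> eval \<Sigma> (T_iter \<Sigma> R i) Var (Fun f es)) sequentially"
    by (rule eventually_sequentially_Suc[THEN iffD1])
  then show ?case by simp
next
  case (Jo t a b)
  then have "eventually (\<lambda>i. t \<in> eval \<Sigma> (T_iter \<Sigma> R i) Var a) sequentially"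
    "eventually (\<lambda>i. t \<in> eval \<Sigma> (T_iter \<Sigma> R i) Var b) sequentially" by auto
  then have "eventually (\<lambda>i. models_join \<Sigma> (T_iter \<Sigma> R i) Var a b) sequentially"
    by eventually_elim (use Jo.hyps(1) in \<open>auto simp: models_join_def\<close>)
  then show ?case by simp
qed

text \<open>\<open>T_omega\<close> is a union, so membership means membership at some stage;
  \<open>eventually\<close> supplies one because \<open>sequentially\<close> is a proper
  filter.\<close>

lemma T_omega_iff_crwl:
  assumes R: "program \<Sigma> R" and f: "f \<in> FS \<Sigma>" and ts: "ts \<in> CTuples \<Sigma> (arf \<Sigma> f)"
  shows "t \<in> T_omega \<Sigma> R f ts \<longleftrightarrow> crwl \<Sigma> R (Red (Fun f ts) t)"
proof -
  have "eval \<Sigma> (T_iter \<Sigma> R i) Var (Fun f ts) = T_iter \<Sigma> R i f ts" for i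
    by (rule eval_Fun_CTuples[OF T_iter_TAlg[OF R] f ts])
  then have "t \<in> T_omega \<Sigma> R f ts \<longleftrightarrow> (\<exists>i. t \<in> eval \<Sigma> (T_iter \<Sigma> R i) Var (Fun f ts))"
    by (simp add: T_omega_def image_image)
  moreover have "wf_trm \<Sigma> (Fun f ts)"
    using f ts by (auto simp: CTuples_iff intro: CTerm_bot_wf)
  moreover have "\<exists>i. t \<in> eval \<Sigma> (T_iter \<Sigma> R i) Var (Fun f ts)" if "crwl \<Sigma> R (Red (Fun f ts) t)"
    using crwl_imp_eval_T_iter[OF R that] eventually_happens'[OF sequentially_bot]
    by (metis (no_types, lifting) formula.case(1))
  ultimately show ?thesis using eval_T_iter_imp_crwl[OF R] by blast
qed

subsection \<open>Closure\<close>

fun leaf_val :: "('v \<Rightarrow> ('c, 'f, 'v) trm) \<Rightarrow> 'v option \<Rightarrow> ('c, 'f, 'v) trm" where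
  "leaf_val \<eta> None = Bot"
| "leaf_val \<eta> (Some x) = \<eta> x"

lemma refills_rel:
  assumes "\<And>t ys. t \<in> set ts \<Longrightarrow> list_all2 P (leaves t) ys \<Longrightarrow> Q t (refill ys t)"
    and "list_all2 P (concat (map leaves ts)) ys"
  shows "list_all2 Q ts (refills ys ts)"
  using assms
proof (induction ts arbitrary: ys)
  case (Cons t ts)
  from Cons.prems(2) obtain ys1 ys2 where ys: "ys = ys1 @ ys2" "list_all2 P (leaves t) ys1"
    "list_all2 P (concat (map leaves ts)) ys2"
    by (auto simp: list_all2_append1)
  have "length ys1 = length (leaves t)" using list_all2_lengthD[OF ys(2)] by simp
  with ys Cons show ?case by auto
qed simp

text \<open>A relation preserved by constructors lifts from leaves to whole terms. Via
  \<open>refills_subst_rel\<close> it is applied with \<open>cle\<close>, to compare instances of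
  the original and the linearised arguments, and with equality, to undo the linearisation.\<close>

lemma refill_rel:
  assumes con: "\<And>c ss ts. c \<in> DS \<Sigma> \<Longrightarrow> length ts = arc \<Sigma> c \<Longrightarrow> list_all2 Q ss ts \<Longrightarrow>
    Q (Con c ss) (Con c ts)"
  shows "t \<in> CTerm_bot \<Sigma> \<Longrightarrow> list_all2 (\<lambda>l y. Q (leaf_val \<eta> l) (\<theta> y)) (leaves t) ys \<Longrightarrow>
    Q (subst \<eta> t) (subst \<theta> (refill ys t))"
proof (induction t arbitrary: ys)
  case (Con c ts)
  have "list_all2 (\<lambda>t t'. Q (subst \<eta> t) (subst \<theta> t')) ts (refills ys ts)"
    using Con by (intro refills_rel) (auto simp: CTuples_iff)
  then show ?case using Con.prems
    by (auto simp: CTuples_iff list_all2_map1 list_all2_map2 dest: list_all2_lengthD intro!: con)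
qed (auto simp: list_all2_Cons1)

lemma refills_subst_rel:
  assumes con: "\<And>c ss ts. c \<in> DS \<Sigma> \<Longrightarrow> length ts = arc \<Sigma> c \<Longrightarrow> list_all2 Q ss ts \<Longrightarrow>
    Q (Con c ss) (Con c ts)"
    and "ts \<in> CTuples \<Sigma> n"
    and "list_all2 (\<lambda>l y. Q (leaf_val \<eta> l) (\<theta> y)) (concat (map leaves ts)) ys"
  shows "list_all2 Q (map (subst \<eta>) ts) (map (subst \<theta>) (refills ys ts))"
  unfolding list_all2_map1 list_all2_map2
proof (rule refills_rel[OF _ assms(3)])
  fix t ys
  assume t: "t \<in> set ts" and ys: "list_all2 (\<lambda>l y. Q (leaf_val \<eta> l) (\<theta> y)) (leaves t) ys"
  have "t \<in> CTerm_bot \<Sigma>" using t assms(2) by (auto simp: CTuples_iff)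
  with con show "Q (subst \<eta> t) (subst \<theta> (refill ys t))" using ys by (rule refill_rel)
qed

text \<open>Used contrapositively: a variable counted at least twice has an occurrence that is not
  its first, and there \<open>crr\<close> imposes a joinability condition.\<close>

lemma count_list_le_1:
  "(\<And>i. i < length L \<Longrightarrow> L ! i = a \<Longrightarrow> a \<notin> set (take i L)) \<Longrightarrow> count_list L a \<le> 1"
proof (induction L rule: rev_induct)
  case (snoc b L)
  have "count_list L a \<le> 1"
  proof (rule snoc.IH)
    fix i assume "i < length L" "L ! i = a"
    then show "a \<notin> set (take i L)" using snoc.prems[of i] by (simp add: nth_append)
  qed
  moreover have "b = a \<Longrightarrow> count_list L a = 0" using snoc.prems[of "length L"]
    by (simp add: count_list_0_iff)
  ultimately show ?case by auto
qed simp

text \<open>\<open>crr\<close> hides its intermediate values inside a \<open>let\<close>; the locale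
  names them. Its assumptions concern only the type of variables, so a single fact interprets it for
  every \<open>ts\<close> and \<open>r\<close>.\<close>

locale crr_data =
  fixes ts :: "('c, 'f, 'v) trm list" and r :: "('c, 'f, 'v) trm"
  assumes count_vars: "countable (UNIV :: 'v set)" and inf_vars: "infinite (UNIV :: 'v set)"
begin

definition L where "L = concat (map leaves ts)"
definition V where "V = \<Union>(vars ` set ts) \<union> vars r"
definition kept where "kept i \<longleftrightarrow> L ! i \<noteq> None \<and> L ! i \<notin> set (take i L)"
definition ys where
  "ys = map (\<lambda>i. if kept i then the (L ! i) else from_nat_into (- V) i) [0..<length L]"
definition conds :: "(('c, 'f, 'v) trm \<times> ('c, 'f, 'v) trm) set" where
  "conds = {(Var x, Var (ys ! i)) | x i. i < length L \<and> L ! i = Some x \<and> \<not> kept i} \<union>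
     {(Var x, Var x) | x. x \<in> vars r \<or> count_list L (Some x) = 1}"

lemma crr_eq: "crr f ts r = Rule f (refills ys ts) r conds"
  unfolding crr_def Let_def conds_def ys_def kept_def L_def V_def by simp

lemma length_ys: "length ys = length L" by (simp add: ys_def)

lemma Some_in_L: "Some x \<in> set L \<longleftrightarrow> x \<in> \<Union>(vars ` set ts)"
  by (auto simp: L_def Some_in_leaves)

lemma nth_L_V: "i < length L \<Longrightarrow> L ! i = Some x \<Longrightarrow> x \<in> V"
  using Some_in_L by (metis nth_mem V_def UnI1)

lemma ys_kept: "i < length L \<Longrightarrow> kept i \<Longrightarrow> L ! i = Some (ys ! i)"
  by (simp add: ys_def kept_def)

lemma ys_fresh: "i < length L \<Longrightarrow> \<not> kept i \<Longrightarrow> ys ! i = from_nat_into (- V) i"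
  by (simp add: ys_def)

text \<open>\<open>V\<close> is finite, so infinitely many variables lie outside it and their
  enumeration is injective; \<open>to_nat_on\<close> reads the leaf position back from a fresh
  variable.\<close>

lemma fresh:
  shows "from_nat_into (- V) i \<notin> V" "to_nat_on (- V) (from_nat_into (- V) i) = i"
proof -
  have "finite V" by (auto simp: V_def finite_vars)
  then have inf: "infinite (- V)" using inf_vars by (metis finite_compl)
  have count: "countable (- V)" using count_vars by (rule countable_subset[rotated]) simp
  show "from_nat_into (- V) i \<notin> V"
    using from_nat_into[of "- V" i] inf by (metis Compl_iff infinite_imp_nonempty)
  show "to_nat_on (- V) (from_nat_into (- V) i) = i"
    using count inf by (rule to_nat_on_from_nat_into_infinite)
qed

text \<open>Every variable of \<open>V\<close> appears in some condition: it occurs in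
  \<open>r\<close>, or once in \<open>ts\<close>, or repeatedly, and then as the partner of a fresh
  variable. Satisfied conditions make it total and equal to its copies, so only leaves
  \<open>Bot\<close> can grow.\<close>

lemma conds_sound:
  assumes \<theta>: "\<theta> \<in> CSubst_bot \<Sigma>"
    and conds: "\<forall>(a, b)\<in>map_prod (subst \<theta>) (subst \<theta>) ` conds. models_join \<Sigma> A Var a b"
  shows "x \<in> V \<Longrightarrow> \<theta> x \<in> CTerm \<Sigma>"
    and "list_all2 (\<lambda>l y. cle \<Sigma> (leaf_val \<theta> l) (\<theta> y)) L ys"
proof -
  have \<theta>': "\<theta> x \<in> CTerm_bot \<Sigma>" for x using \<theta> by (simp add: CSubst_bot_def)
  have join: "\<theta> x = \<theta> y \<and> \<theta> y \<in> CTerm \<Sigma>" if "(Var x, Var y) \<in> conds" for x y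
    using bspec[OF conds imageI[OF that]] by (simp add: models_join_CTerm_bot \<theta>')
  show "\<theta> x \<in> CTerm \<Sigma>" if "x \<in> V"
  proof (cases "x \<in> vars r \<or> count_list L (Some x) = 1")
    case True
    then have "(Var x, Var x) \<in> conds" by (auto simp: conds_def)
    then show ?thesis using join by blast
  next
    case False
    with that have "Some x \<in> set L" by (auto simp: V_def Some_in_L)
    with False have "\<not> count_list L (Some x) \<le> 1"
      by (metis count_list_0_iff le_less less_one)
    then obtain i where i: "i < length L" "L ! i = Some x" "Some x \<in> set (take i L)"
      using count_list_le_1[of L "Some x"] by auto
    then have "(Var x, Var (ys ! i)) \<in> conds" by (auto simp: conds_def kept_def)
    with join show ?thesis by metis
  qed
  show "list_all2 (\<lambda>l y. cle \<Sigma> (leaf_val \<theta> l) (\<theta> y)) L ys"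
    unfolding list_all2_conv_all_nth
  proof (intro conjI allI impI)
    fix i assume i: "i < length L"
    show "cle \<Sigma> (leaf_val \<theta> (L ! i)) (\<theta> (ys ! i))"
    proof (cases "L ! i")
      case None
      then show ?thesis using \<theta>' by (auto intro: cle_bot)
    next
      case (Some x)
      show ?thesis
      proof (cases "kept i")
        case True
        then show ?thesis using ys_kept[OF i] \<theta>' by (auto intro: cle_refl)
      next
        case False
        then have "(Var x, Var (ys ! i)) \<in> conds" using i Some by (auto simp: conds_def)
        then show ?thesis using join Some \<theta>' by (auto intro: cle_refl)
      qed
    qed
  qed (simp add: length_ys)
qed

text \<open>This instance undoes the linearisation done by \<open>crr\<close>: the \<open>i\<close>-th fresh variable goes back to
  the leaf number \<open>i\<close> that it replaced. It witnesses that the closure rules derive all of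
  \<open>T_omega\<close>.\<close>

definition restore :: "'v \<Rightarrow> ('c, 'f, 'v) trm" where
  "restore z = (if z \<in> V then Var z else leaf_val Var (L ! to_nat_on (- V) z))"

lemma restore_CSubst_bot: "restore \<in> CSubst_bot \<Sigma>"
proof -
  have "leaf_val Var l \<in> CTerm_bot \<Sigma>" for l :: "'v option" by (cases l) auto
  then show ?thesis by (simp add: CSubst_bot_def restore_def)
qed

text \<open>A kept variable lies in \<open>V\<close> and is fixed; a fresh one lies outside, and its
  index in the enumeration is its position in \<open>L\<close>.\<close>

lemma restore_ys: "i < length L \<Longrightarrow> restore (ys ! i) = leaf_val Var (L ! i)"
proof (cases "kept i")
  case True
  assume "i < length L"
  with True show ?thesis using ys_kept nth_L_V by (auto simp: restore_def)
next
  case False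
  assume "i < length L"
  with False show ?thesis by (auto simp: restore_def ys_fresh fresh)
qed

lemma restore_args:
  assumes "ts \<in> CTuples \<Sigma> n"
  shows "map (subst restore) (refills ys ts) = ts"
proof -
  have "list_all2 (=) (map (subst Var) ts) (map (subst restore) (refills ys ts))"
  proof (rule refills_subst_rel[where Q = "(=)", OF _ assms])
    show "list_all2 (\<lambda>l y. leaf_val Var l = restore y) (concat (map leaves ts)) ys"
      by (simp add: list_all2_conv_all_nth L_def[symmetric] length_ys restore_ys)
  qed (simp add: list.rel_eq)
  moreover have "map (subst Var) ts = ts" by (simp add: map_idI)
  ultimately show ?thesis by (simp add: list.rel_eq)
qed

lemma restore_rhs: "subst restore r = r"
  using subst_cong[of r restore Var] by (simp add: restore_def V_def)

text \<open>After restoring, both sides of each condition are one and the same variable, which is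
  total.\<close>

lemma restore_conds: "\<forall>(a, b)\<in>map_prod (subst restore) (subst restore) ` conds. models_join \<Sigma> A Var a b"
proof -
  have "x \<in> V" if "x \<in> vars r \<or> count_list L (Some x) = 1" for x
    using that Some_in_L[of x] count_list_0_iff[of L "Some x"] unfolding V_def by fastforce
  then show ?thesis
    by (auto simp: conds_def models_join_CTerm_bot restore_ys)
      (auto simp: restore_def models_join_CTerm_bot dest: nth_L_V)
qed

end

text \<open>For one inclusion, an instance of a closure rule is traced back to an instance of the
  derivation it came from; for the other, \<open>restore\<close> makes the rule built from
  \<open>us\<close> and \<open>t\<close> match \<open>us\<close> exactly.\<close>

lemma T_closure:
  fixes R :: "('c, 'f, 'v) rule set"
  assumes sig: "wf_signature \<Sigma> TYPE('v)" and R: "program \<Sigma> R"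
    and f: "f \<in> FS \<Sigma>" "f \<in> \<sigma>" and us: "us \<in> CTuples \<Sigma> (arf \<Sigma> f)"
  defines "S \<equiv> {crr f ts r | f ts r. f \<in> \<sigma> \<and> ts \<in> CTuples \<Sigma> (arf \<Sigma> f) \<and> r \<in> CTerm_bot \<Sigma> \<and>
    r \<noteq> Bot \<and> crwl \<Sigma> R (Red (Fun f ts) r)}"
  shows "T_rules \<Sigma> S A f us = T_omega \<Sigma> R f us"
proof (intro subset_antisym subsetI)
  have data: "crr_data TYPE('v)" using sig by unfold_locales (auto simp: wf_signature_def)
  note omega = T_omega_TAlg[OF R]
  fix t assume "t \<in> T_rules \<Sigma> S A f us"
  then consider "t = Bot" | ss r' C where "Rule f ss r' C \<in> instances \<Sigma> S"
    "list_all2 (cle \<Sigma>) ss us" "\<forall>(a, b)\<in>C. models_join \<Sigma> A Var a b" "t \<in> eval \<Sigma> A Var r'"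
    by (auto simp: T_rules_def mk_alg_def split: if_splits)
  then show "t \<in> T_omega \<Sigma> R f us"
  proof cases
    case 1
    then show ?thesis using cone_Bot[OF TAlg_cone[OF omega f(1) us]] by simp
  next
    case (2 ss r' C)
    from 2(1) obtain \<theta> g ts r where \<theta>: "\<theta> \<in> CSubst_bot \<Sigma>"
      and eq: "Rule f ss r' C = subst_rule \<theta> (crr g ts r)"
      and ts: "ts \<in> CTuples \<Sigma> (arf \<Sigma> g)" and r: "r \<in> CTerm_bot \<Sigma>"
      and der: "crwl \<Sigma> R (Red (Fun g ts) r)"
      by (auto simp: instances_def S_def)
    interpret crr_data ts r by (rule data)
    from eq have eqs: "g = f" "ss = map (subst \<theta>) (refills ys ts)" "r' = subst \<theta> r"
      "C = map_prod (subst \<theta>) (subst \<theta>) ` conds" by (auto simp: crr_eq)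
    note sound = conds_sound[OF \<theta> 2(3)[unfolded eqs(4)]]
    \<comment> \<open>\<open>\<theta>\<close> may be partial outside \<open>V\<close>, for instance
      at a variable replacing \<open>Bot\<close>. \<open>\<eta>\<close> agrees with it on
      \<open>V\<close>, hence on \<open>ts\<close> and \<open>r\<close>, and is total everywhere, as
      \<open>crwl_subst\<close> demands.\<close>
    define \<eta> where "\<eta> x = (if x \<in> V then \<theta> x else Var x)" for x
    have \<eta>: "\<eta> x \<in> CTerm \<Sigma>" for x using sound(1) by (simp add: \<eta>_def)
    have \<eta>_r: "subst \<eta> r = subst \<theta> r" by (rule subst_cong) (simp add: \<eta>_def V_def)
    have \<eta>_ts: "map (subst \<eta>) ts = map (subst \<theta>) ts"
      by (auto intro!: subst_cong simp: \<eta>_def V_def)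
    let ?vs = "map (subst \<theta>) ts"
    have vs: "?vs \<in> CTuples \<Sigma> (arf \<Sigma> f)"
      using ts eqs(1) \<theta> by (auto simp: CTuples_iff intro: subst_CTerm_bot)
    \<comment> \<open>The linearised arguments can only exceed the original ones, so a result at
      \<open>?vs\<close> reaches \<open>us\<close> by monotonicity of
      \<open>T_omega\<close>.\<close>
    have "list_all2 (cle \<Sigma>) ?vs ss"
      unfolding eqs(2) using sound(2)
      by (intro refills_subst_rel[OF _ ts]) (auto simp: L_def intro: cle_con)
    then have le: "list_all2 (cle \<Sigma>) ?vs us" using 2(2) by (rule list_cle_trans)
    have "t \<in> down \<Sigma> (subst \<theta> r)"
      using 2(4) eqs(3) eval_CTerm_bot[OF subst_CTerm_bot[OF r \<theta>]] by auto
    moreover have "crwl \<Sigma> R (Red (Fun f ?vs) (subst \<theta> r))"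
      using crwl_subst[OF der, of \<eta>, OF \<eta>] by (simp add: \<eta>_r \<eta>_ts eqs(1))
    ultimately have "crwl \<Sigma> R (Red (Fun f ?vs) t)"
      by (auto simp: down_def intro: crwl_down[OF R])
    then have "t \<in> T_omega \<Sigma> R f ?vs" by (simp add: T_omega_iff_crwl[OF R f(1) vs])
    then show ?thesis using TAlg_mono[OF omega f(1) vs us le] by blast
  qed
next
  have data: "crr_data TYPE('v)" using sig by unfold_locales (auto simp: wf_signature_def)
  fix t assume t: "t \<in> T_omega \<Sigma> R f us"
  show "t \<in> T_rules \<Sigma> S A f us"
  proof (cases "t = Bot")
    \<comment> \<open>No closure rule is generated with right-hand side \<open>Bot\<close>; here
      \<open>Bot\<close> is the element that \<open>T_rules\<close> adds by itself.\<close>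
    case True
    then show ?thesis using f us by (simp add: T_rules_def mk_alg_def)
  next
    case False
    interpret crr_data us t by (rule data)
    from t have der: "crwl \<Sigma> R (Red (Fun f us) t)" by (simp add: T_omega_iff_crwl[OF R f(1) us])
    have t': "t \<in> CTerm_bot \<Sigma>" using crwl_Red_wf(2)[OF R der] .
    have "crr f us t \<in> S" unfolding S_def using f us t' False der by blast
    then have "subst_rule restore (crr f us t) \<in> instances \<Sigma> S"
      unfolding instances_def using restore_CSubst_bot by blast
    then have "Rule f us t (map_prod (subst restore) (subst restore) ` conds) \<in> instances \<Sigma> S"
      by (simp add: crr_eq restore_args[OF us] restore_rhs)
    moreover have "t \<in> eval \<Sigma> A Var t"
      using t' by (simp add: eval_CTerm_bot down_def cle_refl)
    ultimately show ?thesis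
      using restore_conds[of \<Sigma> A] list_cle_refl[OF us] f us
      by (intro T_rulesI[OF f(1) us])
  qed
qed

subsection \<open>Renaming\<close>

lemma rename_CTerm_bot: "t \<in> CTerm_bot \<Sigma> \<Longrightarrow> rename_trm \<rho> t = t"
  by (induction t) (auto simp: CTuples_iff map_idI)

text \<open>The values of \<open>\<theta>\<close> contain no function symbols, so renaming leaves
  them alone.\<close>

lemma rename_subst:
  "\<theta> \<in> CSubst_bot \<Sigma> \<Longrightarrow> rename_trm \<rho> (subst \<theta> t) = subst \<theta> (rename_trm \<rho> t)"
  by (induction t) (auto simp: CSubst_bot_def intro!: rename_CTerm_bot[of _ \<Sigma>])

lemma instances_alt: "instances \<Sigma> R = (\<Union>\<theta>\<in>CSubst_bot \<Sigma>. subst_rule \<theta> ` R)"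
  by (auto simp: instances_def)

lemma instances_rename: "instances \<Sigma> (rename_rule \<rho> ` R) = rename_rule \<rho> ` instances \<Sigma> R"
proof -
  have "subst_rule \<theta> (rename_rule \<rho> Q) = rename_rule \<rho> (subst_rule \<theta> Q)"
    if "\<theta> \<in> CSubst_bot \<Sigma>" for \<theta> Q
    by (cases Q) (auto simp: image_image map_prod_def case_prod_beta rename_subst[OF that])
  then show ?thesis
    unfolding instances_alt image_UN image_image by (intro SUP_cong image_cong refl)
qed

lemma eval_rename:
  assumes \<rho>: "renaming \<Sigma> \<rho>" and A: "A \<in> TAlg \<Sigma>"
  shows "wf_trm \<Sigma> e \<Longrightarrow> eval \<Sigma> A Var (rename_trm \<rho> e) = eval \<Sigma> (T_ren \<Sigma> \<rho> A) Var e"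
proof (induction e)
  case (Con c es)
  have IH: "(eval \<Sigma> A Var \<circ> rename_trm \<rho>) e = eval \<Sigma> (T_ren \<Sigma> \<rho> A) Var e" if "e \<in> set es" for e
    unfolding comp_apply by (rule Con.IH[OF that]) (use that Con.prems in simp)
  have "map (eval \<Sigma> A Var \<circ> rename_trm \<rho>) es = map (eval \<Sigma> (T_ren \<Sigma> \<rho> A) Var) es"
    by (rule map_cong[OF refl IH])
  then show ?case by (simp only: trm.map eval.simps map_map id_def)
next
  case (Fun f es)
  let ?B = "T_ren \<Sigma> \<rho> A"
  have IH: "(eval \<Sigma> A Var \<circ> rename_trm \<rho>) e = eval \<Sigma> ?B Var e" if "e \<in> set es" for e
    unfolding comp_apply by (rule Fun.IH[OF that]) (use that Fun.prems in simp)
  have eq: "map (eval \<Sigma> A Var \<circ> rename_trm \<rho>) es = map (eval \<Sigma> ?B Var) es"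
    by (rule map_cong[OF refl IH])
  \<comment> \<open>\<open>T_ren\<close> is empty outside legal tuples, so the two interpretations
    are compared only at tuples reached by evaluation, which are legal by
    \<open>eval_args_CTuples\<close>.\<close>
  have "A (\<rho> f) us = ?B f us" if "list_all2 (\<in>) us (map (eval \<Sigma> ?B Var) es)" for us
    using eval_args_CTuples[OF T_ren_TAlg[OF \<rho> A] _ that] Fun.prems
    by (simp add: T_ren_def mk_alg_def)
  then have "{A (\<rho> f) us | us. list_all2 (\<in>) us (map (eval \<Sigma> ?B Var) es)} =
    {?B f us | us. list_all2 (\<in>) us (map (eval \<Sigma> ?B Var) es)}" by blast
  then show ?case by (simp only: trm.map eval.simps map_map eq)
qed auto

text \<open>\<open>\<rho>\<close> may merge several symbols into \<open>f\<close>. Both sides are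
  brought to a common form: the union, over the preimages \<open>g\<close> of \<open>f\<close>, of
  what the rules for \<open>g\<close> contribute, with \<open>Bot\<close> added.\<close>

lemma T_rename:
  fixes R :: "('c, 'f, 'v) rule set"
  assumes R: "program \<Sigma> R" and \<rho>: "renaming \<Sigma> \<rho>" and A: "A \<in> TAlg \<Sigma>"
  shows "T_rules \<Sigma> (rename_rule \<rho> ` R) A = T_ren_inv \<Sigma> \<rho> (T_rules \<Sigma> R (T_ren \<Sigma> \<rho> A))"
proof (intro ext)
  fix f us
  let ?B = "T_ren \<Sigma> \<rho> A"
  let ?step = "\<lambda>g. {t. \<exists>ss r C. Rule g ss r C \<in> instances \<Sigma> R \<and> list_all2 (cle \<Sigma>) ss us \<and>
    (\<forall>(a, b)\<in>C. models_join \<Sigma> ?B Var a b) \<and> t \<in> eval \<Sigma> ?B Var r}"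
  show "T_rules \<Sigma> (rename_rule \<rho> ` R) A f us = T_ren_inv \<Sigma> \<rho> (T_rules \<Sigma> R ?B) f us"
  proof (cases "f \<in> FS \<Sigma> \<and> us \<in> CTuples \<Sigma> (arf \<Sigma> f)")
    case False
    then show ?thesis by (simp only: T_rules_def T_ren_inv_def mk_alg_outside[OF False])
  next
    case True
    \<comment> \<open>The arguments of an instance are free of function symbols, so renaming leaves
      \<open>ss\<close> intact and acts only on head, right-hand side and conditions.\<close>
    have rule: "Rule f ss r C \<in> instances \<Sigma> (rename_rule \<rho> ` R) \<longleftrightarrow>
      (\<exists>g r0 C0. Rule g ss r0 C0 \<in> instances \<Sigma> R \<and> g \<in> FS \<Sigma> \<and> f = \<rho> g \<and> r = rename_trm \<rho> r0 \<and>
        C = map_prod (rename_trm \<rho>) (rename_trm \<rho>) ` C0)" for ss r C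
    proof -
      have ss: "map (rename_trm \<rho>) ss0 = ss0" if "Rule g ss0 r0 C0 \<in> instances \<Sigma> R" for g ss0 r0 C0
        using instances_wf(2)[OF R that]
        by (intro map_idI rename_CTerm_bot[of _ \<Sigma>]) (auto simp: CTuples_iff)
      have "Rule f ss r C \<in> instances \<Sigma> (rename_rule \<rho> ` R) \<longleftrightarrow>
        (\<exists>g ss0 r0 C0. Rule g ss0 r0 C0 \<in> instances \<Sigma> R \<and>
          Rule f ss r C = rename_rule \<rho> (Rule g ss0 r0 C0))"
        unfolding instances_rename image_iff by (metis rule.exhaust)
      also have "\<dots> \<longleftrightarrow> (\<exists>g r0 C0. Rule g ss r0 C0 \<in> instances \<Sigma> R \<and> g \<in> FS \<Sigma> \<and> f = \<rho> g \<and>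
        r = rename_trm \<rho> r0 \<and> C = map_prod (rename_trm \<rho>) (rename_trm \<rho>) ` C0)"
        using ss instances_wf(1)[OF R] by simp metis
      finally show ?thesis .
    qed
    have sem: "eval \<Sigma> A Var (rename_trm \<rho> r) = eval \<Sigma> ?B Var r"
      "(\<forall>(a, b)\<in>map_prod (rename_trm \<rho>) (rename_trm \<rho>) ` C. models_join \<Sigma> A Var a b) \<longleftrightarrow>
        (\<forall>(a, b)\<in>C. models_join \<Sigma> ?B Var a b)"
      if "Rule g ss r C \<in> instances \<Sigma> R" for g ss r C
    proof -
      note wf = instances_wf[OF R that]
      show "eval \<Sigma> A Var (rename_trm \<rho> r) = eval \<Sigma> ?B Var r"
        by (rule eval_rename[OF \<rho> A wf(3)])
      have "models_join \<Sigma> A Var (rename_trm \<rho> (fst p)) (rename_trm \<rho> (snd p)) =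
        models_join \<Sigma> ?B Var (fst p) (snd p)" if "p \<in> C" for p
        using wf(5)[of "fst p" "snd p"] that by (simp add: models_join_def eval_rename[OF \<rho> A])
      then show "(\<forall>(a, b)\<in>map_prod (rename_trm \<rho>) (rename_trm \<rho>) ` C. models_join \<Sigma> A Var a b) \<longleftrightarrow>
        (\<forall>(a, b)\<in>C. models_join \<Sigma> ?B Var a b)" by (simp add: case_prod_beta)
    qed
    have lhs: "T_rules \<Sigma> (rename_rule \<rho> ` R) A f us = (\<Union>g\<in>{g\<in>FS \<Sigma>. \<rho> g = f}. ?step g) \<union> {Bot}"
    proof -
      have step: "(\<exists>ss r C. Rule f ss r C \<in> instances \<Sigma> (rename_rule \<rho> ` R) \<and> list_all2 (cle \<Sigma>) ss us \<and>
          (\<forall>(a, b)\<in>C. models_join \<Sigma> A Var a b) \<and> t \<in> eval \<Sigma> A Var r) \<longleftrightarrow>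
        (\<exists>g\<in>FS \<Sigma>. \<rho> g = f \<and> t \<in> ?step g)" (is "?l \<longleftrightarrow> ?r") for t
      proof
        assume ?l
        then obtain ss r C where l: "Rule f ss r C \<in> instances \<Sigma> (rename_rule \<rho> ` R)"
          "list_all2 (cle \<Sigma>) ss us" "\<forall>(a, b)\<in>C. models_join \<Sigma> A Var a b" "t \<in> eval \<Sigma> A Var r"
          by blast
        from l(1)[unfolded rule] obtain g r0 C0 where g: "Rule g ss r0 C0 \<in> instances \<Sigma> R"
          "g \<in> FS \<Sigma>" "f = \<rho> g" "r = rename_trm \<rho> r0"
          "C = map_prod (rename_trm \<rho>) (rename_trm \<rho>) ` C0" by blast
        have "t \<in> ?step g"
          using g(1) l(2) l(3)[unfolded g(5) sem(2)[OF g(1)]] l(4)[unfolded g(4) sem(1)[OF g(1)]]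
          by blast
        with g(2,3) show ?r by blast
      next
        assume ?r
        then obtain g ss r0 C0 where g: "g \<in> FS \<Sigma>" "\<rho> g = f" "Rule g ss r0 C0 \<in> instances \<Sigma> R"
          and ss: "list_all2 (cle \<Sigma>) ss us"
          and C: "\<forall>(a, b)\<in>C0. models_join \<Sigma> ?B Var a b" and r: "t \<in> eval \<Sigma> ?B Var r0"
          by blast
        have "Rule f ss (rename_trm \<rho> r0) (map_prod (rename_trm \<rho>) (rename_trm \<rho>) ` C0)
            \<in> instances \<Sigma> (rename_rule \<rho> ` R)"
          unfolding rule using g by blast
        then show ?l
          using ss C[folded sem(2)[OF g(3)]] r[folded sem(1)[OF g(3)]] by blast
      qed
      have "T_rules \<Sigma> (rename_rule \<rho> ` R) A f us =
        {t. \<exists>ss r C. Rule f ss r C \<in> instances \<Sigma> (rename_rule \<rho> ` R) \<and>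
          list_all2 (cle \<Sigma>) ss us \<and> (\<forall>(a, b)\<in>C. models_join \<Sigma> A Var a b) \<and>
          t \<in> eval \<Sigma> A Var r} \<union> {Bot}"
        using True by (simp add: T_rules_def mk_alg_def)
      moreover have "{t. \<exists>g\<in>FS \<Sigma>. \<rho> g = f \<and> t \<in> S g} = (\<Union>g\<in>{g \<in> FS \<Sigma>. \<rho> g = f}. S g)"
        for S :: "'f \<Rightarrow> ('c, 'f, 'v) trm set" by blast
      ultimately show ?thesis by (simp only: step)
    qed
    \<comment> \<open>The tuple \<open>us\<close> has the arity of \<open>f\<close>; arity
      preservation makes it legal for \<open>g\<close> as well.\<close>
    have st: "T_rules \<Sigma> R ?B g us = ?step g \<union> {Bot}" if "g \<in> FS \<Sigma>" "\<rho> g = f" for g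
      using that True \<rho> by (auto simp: T_rules_def mk_alg_def renaming_def)
    \<comment> \<open>Without preimages the union is empty and \<open>Bot\<close> alone remains, as
      in the \<open>else\<close> branch; with a preimage, \<open>Bot\<close> already belongs to each
      \<open>F g\<close>.\<close>
    have glue: "(if \<exists>g\<in>FS \<Sigma>. \<rho> g = f then \<Union>{F g | g. g \<in> FS \<Sigma> \<and> \<rho> g = f} else {Bot}) =
        (\<Union>g\<in>{g \<in> FS \<Sigma>. \<rho> g = f}. S g) \<union> {Bot}"
      if "\<And>g. g \<in> FS \<Sigma> \<Longrightarrow> \<rho> g = f \<Longrightarrow> F g = S g \<union> {Bot}"
      for F S :: "'f \<Rightarrow> ('c, 'f, 'v) trm set"
      using that by auto
    have rhs: "T_ren_inv \<Sigma> \<rho> (T_rules \<Sigma> R ?B) f us = (\<Union>g\<in>{g\<in>FS \<Sigma>. \<rho> g = f}. ?step g) \<union> {Bot}"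
      unfolding T_ren_inv_def mk_alg_def[of \<Sigma>] if_P[OF True] by (rule glue[OF st])
    show ?thesis by (simp only: lhs rhs)
  qed
qed

section \<open>The four module operations on the level of consequence operators\<close>

theorem theorem5p6:
  fixes \<Sigma> :: "('c, 'f) signature"
    and P P1 P2 :: "('c, 'f, 'v) pmodule"
    and \<sigma> :: "'f set"
    and \<rho> :: "'f \<Rightarrow> 'f"
  assumes "wf_signature \<Sigma> TYPE('v)"
    and "is_module \<Sigma> P" and "is_module \<Sigma> P1" and "is_module \<Sigma> P2"
    and "\<sigma> \<subseteq> FS \<Sigma>"
    and "renaming \<Sigma> \<rho>"
  shows "(\<forall>A\<in>TAlg \<Sigma>. T_mod \<Sigma> (union_mod P1 P2) A = (sup (T_mod \<Sigma> P1) (T_mod \<Sigma> P2)) A)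
    \<and> (\<forall>A\<in>TAlg \<Sigma>. T_mod \<Sigma> (closure_mod \<Sigma> P \<sigma>) A = restr_alg \<Sigma> (T_omega \<Sigma> (rl P)) \<sigma>)
    \<and> (\<forall>A\<in>TAlg \<Sigma>. T_mod \<Sigma> (delete_mod P \<sigma>) A = (inf (T_mod \<Sigma> P) (T_top \<Sigma> (exp_syms P - \<sigma>))) A)
    \<and> (\<forall>A\<in>TAlg \<Sigma>.
           T_mod \<Sigma> (rename_mod \<rho> P) A = (T_ren_inv \<Sigma> \<rho> \<circ> T_mod \<Sigma> P \<circ> T_ren \<Sigma> \<rho>) A)"
proof (intro conjI ballI)
  have R: "program \<Sigma> (rl P)" and P: "P = mk_module (rl P)"
    using assms(2) by (auto simp: is_module_def)
  fix A :: "('c, 'f, 'v) talg" assume A: "A \<in> TAlg \<Sigma>"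
  show "T_mod \<Sigma> (union_mod P1 P2) A = (sup (T_mod \<Sigma> P1) (T_mod \<Sigma> P2)) A"
    by (simp add: T_mod_def union_mod_def mk_module_def T_rules_Un)
  show "T_mod \<Sigma> (closure_mod \<Sigma> P \<sigma>) A = restr_alg \<Sigma> (T_omega \<Sigma> (rl P)) \<sigma>"
  proof (intro ext)
    fix f us
    let ?S = "rl (closure_mod \<Sigma> P \<sigma>)"
    \<comment> \<open>\<open>crr\<close> keeps the head symbol, so outside \<open>\<sigma>\<close>
      no closure rule applies and only the added \<open>Bot\<close> remains.\<close>
    have "Rule f ss r C \<notin> instances \<Sigma> ?S" if "f \<notin> \<sigma>" for ss r C
      using that by (auto simp: instances_def closure_mod_def mk_module_def crr_def Let_def)
    then have "T_rules \<Sigma> ?S A f us = mk_alg \<Sigma> (\<lambda>f us. {Bot}) f us" if "f \<notin> \<sigma>"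
      using that by (simp add: T_rules_def mk_alg_def)
    then show "T_mod \<Sigma> (closure_mod \<Sigma> P \<sigma>) A f us = restr_alg \<Sigma> (T_omega \<Sigma> (rl P)) \<sigma> f us"
      using T_closure[OF assms(1) R, of f \<sigma> us A]
      by (cases "f \<in> FS \<Sigma> \<and> us \<in> CTuples \<Sigma> (arf \<Sigma> f)")
        (auto simp: T_mod_def closure_mod_def mk_module_def restr_alg_def mk_alg_def T_rules_def)
  qed
  show "T_mod \<Sigma> (delete_mod P \<sigma>) A = (inf (T_mod \<Sigma> P) (T_top \<Sigma> (exp_syms P - \<sigma>))) A"
  proof (intro ext)
    fix f us
    have exp: "exp_syms P = defined_by (rl P)" by (subst P) (simp add: mk_module_def)
    let ?S = "rl (delete_mod P \<sigma>)"
    have "?S = {Q \<in> rl P. rule_head Q \<notin> \<sigma>}"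
      by (auto simp: delete_mod_def mk_module_def) (metis rule.exhaust rule_head.simps)
    then have inst: "Rule f ss r C \<in> instances \<Sigma> ?S \<longleftrightarrow>
      Rule f ss r C \<in> instances \<Sigma> (rl P) \<and> f \<notin> \<sigma>" for ss r C
      by (simp add: instances_filter[where P = "\<lambda>f. f \<notin> \<sigma>"])
    \<comment> \<open>Only exported symbols have rule instances, so for all others both sides are
      \<open>{Bot}\<close>.\<close>
    have defd: "f \<in> exp_syms P" if "Rule f ss r C \<in> instances \<Sigma> (rl P)" for ss r C
    proof -
      from that obtain \<theta> Q where "Q \<in> rl P" "Rule f ss r C = subst_rule \<theta> Q"
        by (auto simp: instances_def)
      then show ?thesis by (cases Q) (auto simp: exp defined_by_def)
    qed
    show "T_mod \<Sigma> (delete_mod P \<sigma>) A f us =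
      (inf (T_mod \<Sigma> P) (T_top \<Sigma> (exp_syms P - \<sigma>))) A f us"
    proof (cases "f \<in> FS \<Sigma> \<and> us \<in> CTuples \<Sigma> (arf \<Sigma> f)")
      case True
      \<comment> \<open>Values stay inside the carrier, so meeting with \<open>top_alg\<close>
        changes nothing on the retained symbols; on the others it leaves
        \<open>{Bot}\<close>.\<close>
      have "T_rules \<Sigma> (rl P) A f us \<subseteq> CTerm_bot \<Sigma>"
        using TAlg_cone[OF T_rules_TAlg[OF R A]] True by (auto simp: is_cone_def)
      moreover have "T_rules \<Sigma> ?S A f us = (if f \<in> exp_syms P - \<sigma> then T_rules \<Sigma> (rl P) A f us else {Bot})"
        using True defd by (auto simp: T_rules_def mk_alg_def inst)
      moreover have "Bot \<in> T_rules \<Sigma> (rl P) A f us" using True by (simp add: T_rules_def mk_alg_def)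
      ultimately show ?thesis using True
        by (auto simp: T_mod_def T_top_def top_alg_def mk_alg_def)
    next
      case False
      then show ?thesis
        by (simp only: T_mod_def T_rules_def inf_apply mk_alg_outside[OF False] Int_empty_left)
    qed
  qed
  show "T_mod \<Sigma> (rename_mod \<rho> P) A = (T_ren_inv \<Sigma> \<rho> \<circ> T_mod \<Sigma> P \<circ> T_ren \<Sigma> \<rho>) A"
    using T_rename[OF R assms(6) A] by (simp add: T_mod_def rename_mod_def mk_module_def)
qed

end
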